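(* Let $(H,(\mathcal{D}_i)_{i=1}^n)$ be a known i.d. input, where $H=(U,B,F)$ is a type graph with downward-closed probing constraints $(\mathcal{C}_b)_{b\in B}$, and assume $r_i(b):=\mathbb{P}[v_i=b]>0$ for all $i,b$. If $\mathcal{M}$ is the matching returned by the algorithm ROM-ID described below when the online vertices of $G\sim(H,(\mathcal{D}_i)_{i=1}^n)$ are presented in uniformly random order, then $$\mathbb{E}[w(\mathcal{M})]\ \ge\ \left(1-\tfrac1e\right)\mathrm{OPT}(H,(\mathcal{D}_i)_{i=1}^n).$$ Moreover, ROM-ID is non-adaptive.
   Context: Stochastic graphs. A stochastic graph is a finite bipartite graph $G=(U,V,E)$ with $E=U\times V$, nonnegative edge weights $(w_e)$ and edge probabilities $(p_e)\subseteq[0,1]$. Each edge $e$ has a hidden random state $\mathrm{st}(e)\sim\mathrm{Ber}(p_e)$, independent across edges; $e$ is active if $\mathrm{st}(e)=1$. For a finite set $S$, $S^{( * )}$ is the set of tuples (strings) of pairwise distinct elements of $S$, including the empty string $\lambda$. $\partial(v)$ is the set of edges incident to $v$. Each $v\in V$ has a probing constraint $\mathcal{C}_v\subseteq\partial(v)^{( * )}$, downward-closed: if $\bm e\in\mathcal{C}_v$ then every substring and every permutation of $\bm e$ is in $\mathcal{C}_v$. $w(M)=\sum_{e\in M}w_e$. Probe-commit model. Probing an edge reveals its state. If a probed edge is active, the algorithm must irrevocably decide whether to add it to its matching before probing any other edge; only probed active edges may be added; the output must be a matching. An offline probing algorithm knows $G$ (not the states) and adaptively (possibly randomly) probes edges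 in any order so that for every $v\in V$ the sequence of probed edges of $\partial(v)$, in order, lies in $\mathcal{C}_v$. $\mathrm{OPT}(G)$ is the supremum over offline probing algorithms of the expected weight of the returned matching. Known i.d. input. A type graph is a stochastic graph $H=(U,B,F)$ with weights $w_{u,b}$, probabilities $p_{u,b}$, downward-closed constraints $(\mathcal{C}_b)_{b\in B}$. Given $n\ge1$ and distributions $\mathcal{D}_1,\dots,\mathcal{D}_n$ on $B$, the instantiated graph $G=(U,V,E)$, $V=\{v_1,\dots,v_n\}$, is drawn by independently choosing the type of $v_i$ from $\mathcal{D}_i$ (written $v_i=b$); $v_i$ is a copy of its type $b$ (edge $(u,v_i)$ has weight $w_{u,b}$, probability $p_{u,b}$; constraint a copy of $\mathcal{C}_b$); edge states are independent. $\mathrm{OPT}(H,(\mathcal{D}_i)):=\mathbb{E}[\mathrm{OPT}(G)]$. Random order arrival: the vertices are presented one at a time in a uniformly random order (equivalently, each $v_t$ gets an independent uniform arrival time $\widetilde Y_t\in[0,1]$ and vertices arrive in increasing order of $\widetilde Y_t$); on arrival the algorithm learns the index $t$ and the type of $v_t$ (not edge states), and probes only edges of $\partial(v_t)$, respecting $\mathcal{C}_{v_t}$ and commitment, before the next arrival. An online probing algorithm is non-adaptive if the edges it probes at the current arrival are a (randomized) function only of the input $(H,(\mathcal{D}_i))$ and of the index and type of the current arrival, i.e. they do not depend on the states of previously probed edges, previous types, or previous matching decisions. LP. For $\bm e=(e_1,\dots,e_k)$ let $g(\bm e)=\prod_{j=1}^k(1-p_{e_j})$, $g(\lambda)=1$,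 $\bm e_{<e_j}=(e_1,\dots,e_{j-1})$, $\mathrm{val}(\bm e)=\sum_{j=1}^k p_{e_j}w_{e_j}g(\bm e_{<e_j})$. LP-config-id has variables $x_i(\bm e\|b)\ge0$ ($i\in[n]$, $b\in B$, $\bm e\in\mathcal{C}_b$): maximize $\sum_{i,b,\bm e}\mathrm{val}(\bm e)x_i(\bm e\|b)$ subject to $\sum_{i,b}\sum_{\bm e\in\mathcal{C}_b:(u,b)\in\bm e}p_{u,b}g(\bm e_{<(u,b)})x_i(\bm e\|b)\le1$ for all $u\in U$ and $\sum_{\bm e\in\mathcal{C}_b}x_i(\bm e\|b)=r_i(b)$ for all $b,i$. Define $\widetilde x_{u,i}(b):=\sum_{\bm e\in\mathcal{C}_b:(u,b)\in\bm e}g(\bm e_{<(u,b)})x_i(\bm e\|b)$ and $z_{u,i}:=\sum_b p_{u,b}\widetilde x_{u,i}(b)$. VertexProbe on $v_i$ of type $a$: draw $\bm e'\in\mathcal{C}_a$ with probability $x_i(\bm e'\|a)/r_i(a)$, probe its edges in order until one is active and output that edge (nothing if none). Algorithm ROM-ID: compute an optimal solution of LP-config-id; $\mathcal{M}=\emptyset$; for $t\in[n]$ in increasing order of $\widetilde Y_t$: run VertexProbe on $v_t$; if it outputs $(u,v_t)$ and $u$ is unmatched, add $(u,v_t)$ to $\mathcal{M}$ independently with probability $\exp(-\widetilde Y_t\, z_{u,t})$. Return $\mathcal{M}$. *)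

theory Defs
  imports "HOL-Probability.Probability" "HOL-Library.Sublist"
begin

section \<open>Stochastic graphs\<close>

text \<open>The edge set is always the full product of \<open>off\<close> and \<open>onl\<close>, so it is not a field.\<close>

record ('u, 'v) sgraph =
  off :: "'u set"
  onl :: "'v set"
  wt :: "'u \<times> 'v \<Rightarrow> real"
  pr :: "'u \<times> 'v \<Rightarrow> real"
  con :: "'v \<Rightarrow> ('u \<times> 'v) list set"

definition edges :: "('u, 'v) sgraph \<Rightarrow> ('u \<times> 'v) set" where
  "edges G = off G \<times> onl G"

definition star :: "('u, 'v) sgraph \<Rightarrow> 'v \<Rightarrow> ('u \<times> 'v) set" where
  "star G v = off G \<times> {v}"

definition strings :: "'a set \<Rightarrow> 'a list set" where
  "strings S = {es. distinct es \<and> set es \<subseteq> S}"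

definition downward_closed :: "'a list set \<Rightarrow> bool" where
  "downward_closed C \<longleftrightarrow>
     (\<forall>es\<in>C. (\<forall>fs. sublist fs es \<longrightarrow> fs \<in> C) \<and> (\<forall>fs. mset fs = mset es \<longrightarrow> fs \<in> C))"

definition stochastic_graph :: "('u, 'v) sgraph \<Rightarrow> bool" where
  "stochastic_graph G \<longleftrightarrow>
     finite (off G) \<and> finite (onl G) \<and>
     (\<forall>e\<in>edges G. 0 \<le> wt G e \<and> 0 \<le> pr G e \<and> pr G e \<le> 1) \<and>
     (\<forall>v\<in>onl G. con G v \<subseteq> strings (star G v) \<and> downward_closed (con G v))"

definition matching :: "('u \<times> 'v) set \<Rightarrow> bool" where
  "matching M \<longleftrightarrow> (\<forall>e\<in>M. \<forall>f\<in>M. e \<noteq> f \<longrightarrow> fst e \<noteq> fst f \<and> snd e \<noteq> snd f)"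

definition states_pmf :: "('u, 'v) sgraph \<Rightarrow> ('u \<times> 'v \<Rightarrow> bool) pmf" where
  "states_pmf G = Pi_pmf (edges G) False (\<lambda>e. bernoulli_pmf (pr G e))"


section \<open>Probing in the probe-commit model\<close>

text \<open>
  An adaptive probing strategy is a decision tree. \<open>Probe e k0 k1\<close> probes \<open>e\<close>; if \<open>e\<close> is inactive
  it continues with a tree drawn from \<open>k0\<close>; if \<open>e\<close> is active it draws from \<open>k1\<close> the irrevocable
  decision whether to add \<open>e\<close> to the matching, together with the tree to continue with.
  A randomized strategy is a probability distribution on trees. As a feasible strategy has only
  finitely many actions to choose from at each step, discrete distributions are no restriction.
\<close>

datatype 'e ptree = Halt | Probe 'e "'e ptree pmf" "(bool \<times> 'e ptree) pmf"

text \<open>A trace lists the probed edges in order, each with its state and whether it was added.\<close>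

type_synonym 'e trace = "('e \<times> bool \<times> bool) list"

primrec run_tree :: "('e \<Rightarrow> bool) \<Rightarrow> 'e ptree \<Rightarrow> 'e trace pmf" where
  "run_tree st Halt = return_pmf []"
| "run_tree st (Probe e k0 k1) =
     (if st e
      then bind_pmf (map_pmf (map_prod id (run_tree st)) k1)
             (\<lambda>(a, R). map_pmf (\<lambda>h. (e, True, a) # h) R)
      else bind_pmf (map_pmf (run_tree st) k0)
             (\<lambda>R. map_pmf (\<lambda>h. (e, False, False) # h) R))"

definition probed :: "'e trace \<Rightarrow> 'e list" where
  "probed h = map fst h"

definition chosen :: "'e trace \<Rightarrow> 'e set" where
  "chosen h = {e. \<exists>s. (e, s, True) \<in> set h}"

definition trace_weight :: "('u, 'v) sgraph \<Rightarrow> ('u \<times> 'v) trace \<Rightarrow> real" where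
  "trace_weight G h = (\<Sum>e\<in>chosen h. wt G e)"

definition feasible_trace :: "('u, 'v) sgraph \<Rightarrow> ('u \<times> 'v) trace \<Rightarrow> bool" where
  "feasible_trace G h \<longleftrightarrow>
     set (probed h) \<subseteq> edges G \<and>
     (\<forall>v\<in>onl G. filter (\<lambda>e. snd e = v) (probed h) \<in> con G v) \<and>
     matching (chosen h)"

definition offline_run ::
    "('u, 'v) sgraph \<Rightarrow> ('u \<times> 'v) ptree pmf \<Rightarrow> ('u \<times> 'v) trace pmf" where
  "offline_run G A = bind_pmf (states_pmf G) (\<lambda>st. bind_pmf A (run_tree st))"

definition offline_algorithms :: "('u, 'v) sgraph \<Rightarrow> ('u \<times> 'v) ptree pmf set" where
  "offline_algorithms G = {A. \<forall>h\<in>set_pmf (offline_run G A). feasible_trace G h}"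

definition OPT :: "('u, 'v) sgraph \<Rightarrow> real" where
  "OPT G = (SUP A\<in>offline_algorithms G. measure_pmf.expectation (offline_run G A) (trace_weight G))"


section \<open>Known i.d. inputs\<close>

text \<open>
  A type graph is a stochastic graph \<open>H\<close> whose online side \<open>onl H\<close> is the set of types.
  The vertex \<open>v\<^sub>i\<close> of the instantiated graph is represented by its index \<open>i \<in> {1..n}\<close>; \<open>\<tau> i\<close> is its type.
\<close>

definition instantiate :: "('u, 'b) sgraph \<Rightarrow> nat \<Rightarrow> (nat \<Rightarrow> 'b) \<Rightarrow> ('u, nat) sgraph" where
  "instantiate H n \<tau> =
     \<lparr> off = off H, onl = {1..n},
       wt = (\<lambda>(u, i). wt H (u, \<tau> i)),
       pr = (\<lambda>(u, i). pr H (u, \<tau> i)),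
       con = (\<lambda>i. map (\<lambda>(u, b). (u, i)) ` con H (\<tau> i)) \<rparr>"

definition types_pmf :: "nat \<Rightarrow> (nat \<Rightarrow> 'b pmf) \<Rightarrow> (nat \<Rightarrow> 'b) pmf" where
  "types_pmf n D = Pi_pmf {1..n} undefined D"

definition known_id_input :: "('u, 'b) sgraph \<Rightarrow> nat \<Rightarrow> (nat \<Rightarrow> 'b pmf) \<Rightarrow> bool" where
  "known_id_input H n D \<longleftrightarrow>
     stochastic_graph H \<and> n \<ge> 1 \<and> (\<forall>i\<in>{1..n}. set_pmf (D i) \<subseteq> onl H)"

definition OPT_id :: "('u, 'b) sgraph \<Rightarrow> nat \<Rightarrow> (nat \<Rightarrow> 'b pmf) \<Rightarrow> real" where
  "OPT_id H n D = measure_pmf.expectation (types_pmf n D) (\<lambda>\<tau>. OPT (instantiate H n \<tau>))"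


section \<open>Online probing with random order arrivals\<close>

text \<open>
  One entry per processed arrival: index, type, arrival time, and what happened on that arrival.
\<close>

type_synonym ('u, 'b) past = "(nat \<times> 'b \<times> real \<times> ('u \<times> nat) trace) list"

text \<open>
  On each arrival an online algorithm selects a randomized probing strategy from the past, and the
  index, type and arrival time of the current vertex.
\<close>

type_synonym ('u, 'b) online_alg =
  "('u, 'b) past \<Rightarrow> nat \<Rightarrow> 'b \<Rightarrow> real \<Rightarrow> ('u \<times> nat) ptree pmf"

definition past_trace :: "('u, 'b) past \<Rightarrow> ('u \<times> nat) trace" where
  "past_trace past = concat (map (\<lambda>(i, b, y, h). h) past)"

primrec process_arrivals ::
    "('u, 'b) online_alg \<Rightarrow> (nat \<Rightarrow> 'b) \<Rightarrow> (nat \<Rightarrow> real) \<Rightarrow> ('u \<times> nat \<Rightarrow> bool) \<Rightarrow>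
     nat list \<Rightarrow> ('u, 'b) past \<Rightarrow> ('u, 'b) past pmf" where
  "process_arrivals A \<tau> Y st [] past = return_pmf past"
| "process_arrivals A \<tau> Y st (i # is) past =
     bind_pmf (A past i (\<tau> i) (Y i)) (\<lambda>T.
     bind_pmf (run_tree st T) (\<lambda>h.
     process_arrivals A \<tau> Y st is (past @ [(i, \<tau> i, Y i, h)])))"

text \<open>
  The run for given arrival times \<open>Y\<close>. The vertices are processed in increasing order of \<open>Y\<close>; ties,
  which have probability zero, are broken by index.
\<close>

definition online_run ::
    "('u, 'b) sgraph \<Rightarrow> nat \<Rightarrow> (nat \<Rightarrow> 'b pmf) \<Rightarrow> ('u, 'b) online_alg \<Rightarrow> (nat \<Rightarrow> real) \<Rightarrow>
     ((nat \<Rightarrow> 'b) \<times> ('u, 'b) past) pmf" where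
  "online_run H n D A Y =
     bind_pmf (types_pmf n D) (\<lambda>\<tau>.
     bind_pmf (states_pmf (instantiate H n \<tau>)) (\<lambda>st.
     map_pmf (Pair \<tau>) (process_arrivals A \<tau> Y st (sort_key Y [1..<Suc n]) [])))"

definition arrival_times :: "nat \<Rightarrow> (nat \<Rightarrow> real) measure" where
  "arrival_times n = Pi\<^sub>M {1..n} (\<lambda>_. uniform_measure lborel {0..1})"

definition online_expected_weight ::
    "('u, 'b) sgraph \<Rightarrow> nat \<Rightarrow> (nat \<Rightarrow> 'b pmf) \<Rightarrow> ('u, 'b) online_alg \<Rightarrow> real" where
  "online_expected_weight H n D A =
     (LINT Y|arrival_times n.
        measure_pmf.expectation (online_run H n D A Y)
          (\<lambda>(\<tau>, past). trace_weight (instantiate H n \<tau>) (past_trace past)))"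

definition online_algorithm ::
    "('u, 'b) sgraph \<Rightarrow> nat \<Rightarrow> (nat \<Rightarrow> 'b pmf) \<Rightarrow> ('u, 'b) online_alg \<Rightarrow> bool" where
  "online_algorithm H n D A \<longleftrightarrow>
     (\<forall>Y. (\<forall>i\<in>{1..n}. 0 \<le> Y i \<and> Y i \<le> 1) \<longrightarrow>
        (\<forall>(\<tau>, past)\<in>set_pmf (online_run H n D A Y).
           (\<forall>(i, b, y, h)\<in>set past. set (probed h) \<subseteq> star (instantiate H n \<tau>) i) \<and>
           feasible_trace (instantiate H n \<tau>) (past_trace past)))"

text \<open>
  Non-adaptivity: the law \<open>\<rho> i b st\<close> of the edges probed on the current arrival depends neither on
  the past nor on the arrival time. The states \<open>st\<close> of the edges of the current vertex itself enter
  in one way only: the algorithm goes through a string drawn from a distribution \<open>\<kappa> i b\<close>, which does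
  not depend on \<open>st\<close>, and it may stop early after an edge that turned out to be active.
  The coupling of string and probed edges is expressed by \<open>rel_pmf\<close>.
\<close>

definition non_adaptive ::
    "('u, 'b) sgraph \<Rightarrow> nat \<Rightarrow> (nat \<Rightarrow> 'b pmf) \<Rightarrow> ('u, 'b) online_alg \<Rightarrow> bool" where
  "non_adaptive H n D A \<longleftrightarrow>
     online_algorithm H n D A \<and>
     (\<exists>\<kappa> \<rho>. \<forall>i\<in>{1..n}. \<forall>b\<in>onl H. \<forall>st.
        (\<forall>past y. map_pmf probed (bind_pmf (A past i b y) (run_tree st)) = \<rho> i b st) \<and>
        rel_pmf (\<lambda>es fs. prefix fs es \<and> (fs = es \<or> (fs \<noteq> [] \<and> st (last fs))))
          (\<kappa> i b) (\<rho> i b st))"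


section \<open>The configuration LP\<close>

definition gprob :: "('u, 'b) sgraph \<Rightarrow> ('u \<times> 'b) list \<Rightarrow> real" where
  "gprob H es = (\<Prod>e\<leftarrow>es. 1 - pr H e)"

definition before :: "'a \<Rightarrow> 'a list \<Rightarrow> 'a list" where
  "before e es = takeWhile (\<lambda>f. f \<noteq> e) es"

definition val :: "('u, 'b) sgraph \<Rightarrow> ('u \<times> 'b) list \<Rightarrow> real" where
  "val H es = (\<Sum>e\<leftarrow>es. pr H e * wt H e * gprob H (before e es))"

text \<open>\<open>x i es b\<close> is the variable \<open>x\<^sub>i(es \<parallel> b)\<close>; only its values for \<open>i \<in> {1..n}\<close>, \<open>b \<in> onl H\<close>
  and \<open>es \<in> con H b\<close> matter.\<close>

type_synonym ('u, 'b) lp_var = "nat \<Rightarrow> ('u \<times> 'b) list \<Rightarrow> 'b \<Rightarrow> real"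

definition lp_feasible ::
    "('u, 'b) sgraph \<Rightarrow> nat \<Rightarrow> (nat \<Rightarrow> 'b pmf) \<Rightarrow> ('u, 'b) lp_var \<Rightarrow> bool" where
  "lp_feasible H n D x \<longleftrightarrow>
     (\<forall>i\<in>{1..n}. \<forall>b\<in>onl H. \<forall>es\<in>con H b. 0 \<le> x i es b) \<and>
     (\<forall>u\<in>off H. (\<Sum>i=1..n. \<Sum>b\<in>onl H. \<Sum>es\<in>{es\<in>con H b. (u, b) \<in> set es}.
         pr H (u, b) * gprob H (before (u, b) es) * x i es b) \<le> 1) \<and>
     (\<forall>i\<in>{1..n}. \<forall>b\<in>onl H. (\<Sum>es\<in>con H b. x i es b) = pmf (D i) b)"

definition lp_value :: "('u, 'b) sgraph \<Rightarrow> nat \<Rightarrow> ('u, 'b) lp_var \<Rightarrow> real" where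
  "lp_value H n x = (\<Sum>i=1..n. \<Sum>b\<in>onl H. \<Sum>es\<in>con H b. val H es * x i es b)"

definition lp_optimal ::
    "('u, 'b) sgraph \<Rightarrow> nat \<Rightarrow> (nat \<Rightarrow> 'b pmf) \<Rightarrow> ('u, 'b) lp_var \<Rightarrow> bool" where
  "lp_optimal H n D x \<longleftrightarrow>
     lp_feasible H n D x \<and> (\<forall>x'. lp_feasible H n D x' \<longrightarrow> lp_value H n x' \<le> lp_value H n x)"

text \<open>An optimal solution always exists, unless some constraint does not even contain the empty
  string, in which case the LP is infeasible.\<close>

lemma finite_con:
  assumes "stochastic_graph H" "b \<in> onl H"
  shows "finite (con H b)"
proof -
  have "finite (star H b)" using assms by (auto simp: stochastic_graph_def star_def)
  then have "finite {es. set es \<subseteq> star H b \<and> distinct es}"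
    by (rule finite_subset_distinct)
  then show ?thesis using assms
    by (auto simp: stochastic_graph_def strings_def conj_commute elim!: finite_subset[rotated])
qed

lemma lp_optimal_exists:
  assumes id: "known_id_input H n D" and ne: "\<forall>b\<in>onl H. con H b \<noteq> {}"
  shows "\<exists>x. lp_optimal H n D x"
proof -
  let ?B = "onl H"
  have G: "stochastic_graph H" using id by (simp add: known_id_input_def)
  have fin: "finite (con H b)" if "b \<in> ?B" for b using finite_con[OF G that] .
  have nil: "[] \<in> con H b" if b: "b \<in> ?B" for b
  proof -
    obtain es where "es \<in> con H b" using ne b by blast
    moreover have "downward_closed (con H b)" using G b by (simp add: stochastic_graph_def)
    moreover have "sublist [] es" by simp
    ultimately show ?thesis unfolding downward_closed_def by blast
  qed
  define J where "J = {(i, b, es). i \<in> {1..n} \<and> b \<in> ?B \<and> es \<in> con H b}"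
  define X :: "(nat \<times> 'b \<times> ('a \<times> 'b) list \<Rightarrow> real) \<Rightarrow> ('a, 'b) lp_var"
    where "X = (\<lambda>f i es b. f (i, b, es))"
  define K :: "(nat \<times> 'b \<times> ('a \<times> 'b) list \<Rightarrow> real) set"
    where "K = Pi\<^sub>E UNIV (\<lambda>t. if t \<in> J then {0..1} else {0})"
  have "compactin (product_topology (\<lambda>_. euclidean) UNIV) K"
    unfolding K_def compactin_PiE by auto
  then have "compact K"
    by (simp add: euclidean_product_topology)
  have cont: "continuous_on UNIV (\<lambda>f. X f i es b)" for i es b
    unfolding X_def by (rule continuous_on_product_coordinates)
  have "closed {f. lp_feasible H n D (X f)}"
    unfolding lp_feasible_def Ball_def
    by (intro closed_Collect_conj closed_Collect_all closed_Collect_imp open_Collect_const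
          closed_Collect_le closed_Collect_eq continuous_on_sum continuous_on_mult
          continuous_on_const cont)
  then have cpt: "compact (K \<inter> {f. lp_feasible H n D (X f)})"
    using \<open>compact K\<close> by (rule compact_Int_closed[rotated])
  define f0 :: "nat \<times> 'b \<times> ('a \<times> 'b) list \<Rightarrow> real"
    where "f0 = (\<lambda>(i, b, es). if (i, b, es) \<in> J \<and> es = [] then pmf (D i) b else 0)"
  have "f0 \<in> K" by (auto simp: K_def f0_def pmf_le_1)
  moreover have "lp_feasible H n D (X f0)"
    unfolding lp_feasible_def
  proof (intro conjI ballI)
    fix u
    have "(\<Sum>i=1..n. \<Sum>b\<in>?B. \<Sum>es\<in>{es\<in>con H b. (u, b) \<in> set es}.
         pr H (u, b) * gprob H (before (u, b) es) * X f0 i es b) = 0"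
      by (intro sum.neutral ballI) (auto simp: X_def f0_def)
    then show "(\<Sum>i=1..n. \<Sum>b\<in>?B. \<Sum>es\<in>{es\<in>con H b. (u, b) \<in> set es}.
         pr H (u, b) * gprob H (before (u, b) es) * X f0 i es b) \<le> 1" by simp
  next
    fix i b assume ib: "i \<in> {1..n}" "b \<in> ?B"
    have "(\<Sum>es\<in>con H b. X f0 i es b) = (\<Sum>es\<in>con H b. if es = [] then pmf (D i) b else 0)"
      using ib by (intro sum.cong) (auto simp: X_def f0_def J_def)
    also have "\<dots> = pmf (D i) b" using ib fin nil by (simp add: sum.delta)
    finally show "(\<Sum>es\<in>con H b. X f0 i es b) = pmf (D i) b" .
  qed (auto simp: X_def f0_def)
  ultimately have "K \<inter> {f. lp_feasible H n D (X f)} \<noteq> {}" by blast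
  moreover have "continuous_on (K \<inter> {f. lp_feasible H n D (X f)}) (\<lambda>f. lp_value H n (X f))"
    unfolding lp_value_def
    by (rule continuous_on_subset[where s = UNIV])
       (intro continuous_on_sum continuous_on_mult continuous_on_const cont, simp)
  ultimately obtain f where f: "lp_feasible H n D (X f)"
    and max: "\<And>f'. f' \<in> K \<Longrightarrow> lp_feasible H n D (X f') \<Longrightarrow> lp_value H n (X f') \<le> lp_value H n (X f)"
    using continuous_attains_sup[OF cpt] by blast
  have "lp_value H n x \<le> lp_value H n (X f)" if x: "lp_feasible H n D x" for x
  proof -
    define f' where "f' = (\<lambda>(i, b, es). if (i, b, es) \<in> J then x i es b else 0)"
    have eq: "X f' i es b = x i es b" if "i \<in> {1..n}" "b \<in> ?B" "es \<in> con H b" for i es b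
      using that by (simp add: X_def f'_def J_def)
    have "(\<Sum>i=1..n. \<Sum>b\<in>?B. \<Sum>es\<in>{es\<in>con H b. (u, b) \<in> set es}.
            pr H (u, b) * gprob H (before (u, b) es) * X f' i es b) =
          (\<Sum>i=1..n. \<Sum>b\<in>?B. \<Sum>es\<in>{es\<in>con H b. (u, b) \<in> set es}.
            pr H (u, b) * gprob H (before (u, b) es) * x i es b)" for u
      by (intro sum.cong refl) (use eq in auto)
    then have "lp_feasible H n D (X f')"
      using x eq unfolding lp_feasible_def by (simp cong: sum.cong)
    moreover have "lp_value H n (X f') = lp_value H n x"
      unfolding lp_value_def by (intro sum.cong) (auto simp: eq)
    moreover have "f' \<in> K"
    proof -
      have "0 \<le> x i es b \<and> x i es b \<le> 1" if t: "i \<in> {1..n}" "b \<in> ?B" "es \<in> con H b" for i b es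
      proof -
        have "x i es b \<le> (\<Sum>es\<in>con H b. x i es b)"
          using x t fin by (intro member_le_sum) (auto simp: lp_feasible_def)
        also have "\<dots> = pmf (D i) b" using x t by (auto simp: lp_feasible_def)
        finally show ?thesis
          using x t pmf_le_1[of "D i" b] by (auto simp: lp_feasible_def)
      qed
      then show ?thesis by (auto simp: K_def f'_def J_def)
    qed
    ultimately show ?thesis using max by metis
  qed
  with f show ?thesis unfolding lp_optimal_def by blast
qed

definition xtilde :: "('u, 'b) sgraph \<Rightarrow> ('u, 'b) lp_var \<Rightarrow> 'u \<Rightarrow> nat \<Rightarrow> 'b \<Rightarrow> real" where
  "xtilde H x u i b =
     (\<Sum>es\<in>{es\<in>con H b. (u, b) \<in> set es}. gprob H (before (u, b) es) * x i es b)"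

definition zval :: "('u, 'b) sgraph \<Rightarrow> ('u, 'b) lp_var \<Rightarrow> 'u \<Rightarrow> nat \<Rightarrow> real" where
  "zval H x u i = (\<Sum>b\<in>onl H. pr H (u, b) * xtilde H x u i b)"


section \<open>The algorithm ROM-ID\<close>

definition string_pmf ::
    "('u, 'b) sgraph \<Rightarrow> (nat \<Rightarrow> 'b pmf) \<Rightarrow> ('u, 'b) lp_var \<Rightarrow> nat \<Rightarrow> 'b \<Rightarrow> ('u \<times> 'b) list pmf" where
  "string_pmf H D x i a = embed_pmf (\<lambda>es. if es \<in> con H a then x i es a / pmf (D i) a else 0)"

text \<open>Probe the edges of a string in order until one is active; add this edge \<open>e\<close> according to the
  outcome of \<open>accept e\<close>, and stop.\<close>

primrec probe_until_active :: "('e \<Rightarrow> bool pmf) \<Rightarrow> 'e list \<Rightarrow> 'e ptree" where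
  "probe_until_active accept [] = Halt"
| "probe_until_active accept (e # es) =
     Probe e (return_pmf (probe_until_active accept es))
             (map_pmf (\<lambda>a. (a, Halt)) (accept e))"

definition rom_accept ::
    "('u, 'b) sgraph \<Rightarrow> ('u, 'b) lp_var \<Rightarrow> ('u, 'b) past \<Rightarrow> real \<Rightarrow> 'u \<times> nat \<Rightarrow> bool pmf" where
  "rom_accept H x past y = (\<lambda>(u, i).
     if u \<in> fst ` chosen (past_trace past) then return_pmf False
     else bernoulli_pmf (exp (- y * zval H x u i)))"

definition rom_id ::
    "('u, 'b) sgraph \<Rightarrow> (nat \<Rightarrow> 'b pmf) \<Rightarrow> ('u, 'b) lp_var \<Rightarrow> ('u, 'b) online_alg" where
  "rom_id H D x = (\<lambda>past i a y.
     map_pmf (\<lambda>es. probe_until_active (rom_accept H x past y) (map (\<lambda>(u, b). (u, i)) es))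
       (string_pmf H D x i a))"

end

theory Submission
  imports Defs
begin

text \<open>
  The LP is a relaxation. An adaptive algorithm may be assumed to decide before each probe whether it
  would accept the edge: if it would not, the state can be simulated by a private coin. For a fixed
  online vertex \<open>v\<close> this leaves a random string of committed probes, drawn by pretending that every edge
  of \<open>v\<close> is inactive, and an edge of the string is reached with probability the product of the
  \<open>1 - p\<close> before it. The laws of these strings, averaged over the types, form a feasible LP solution
  with the value of the algorithm.

  The rounding. Given the arrival times \<open>Y\<close>, the vertices act on a fixed offline vertex \<open>u\<close> independently:
  \<open>i\<close> would take \<open>u\<close> with probability \<open>z\<^sub>i exp (- Y\<^sub>i z\<^sub>i)\<close>, and \<open>\<integral>\<^sub>0\<^sup>y z exp (- s z) ds = 1 - exp (- y z)\<close>.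
  Hence \<open>u\<close> is still free for a vertex \<open>t\<close> arriving at time \<open>y\<close>, and passes its acceptance coin, with
  probability \<open>exp (- y (\<Sum>i. z\<^sub>i)) \<ge> exp (- y)\<close>; integrating over \<open>y\<close> gives \<open>1 - 1/e\<close>.
\<close>

section \<open>Discrete distributions\<close>

text \<open>Edge states are drawn before a run, whereas the calculations need their independence at
  the moment of a probe. Deferred decisions bridge this, since no feasible trace probes an edge
  twice. A second obstacle: feasibility is known only for traces of positive probability, so it
  passes to a subtree only along such branches, and edges of probability 0 or 1 need care
  throughout.

  Under an adaptive algorithm the strings of different online vertices are correlated. This is
  harmless because the LP is linear and sees only their marginals.

  The acceptance function \<open>a(y) = exp (- y * z)\<close> is the solution of a(y) = 1 - z *
  (integral of a over [0, y]). So the coin of a vertex at time y succeeds with exactly the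
  probability that the same vertex, arriving at a uniform time, would not have taken
  \<open>u\<close> before y. The coin of \<open>t\<close> thereby supplies the one factor missing
  from the product over the other vertices, and the result depends on the \<open>z\<close> only
  through their sum, which the LP bounds by 1.\<close>

lemma expectation_bind_pmf:
  fixes f :: "'b \<Rightarrow> real"
  assumes "\<And>y. \<bar>f y\<bar> \<le> B"
  shows "measure_pmf.expectation (bind_pmf p g) f =
         measure_pmf.expectation p (\<lambda>x. measure_pmf.expectation (g x) f)"
  unfolding measure_pmf_bind
  by (rule integral_bind[where K = "count_space UNIV" and B = B and B' = 1])
     (use assms in \<open>auto simp: measure_pmf.emeasure_space_1 measure_pmf_in_subprob_algebra
        simp flip: space_measure_pmf\<close>)

lemma prob_bind_pmf:
  "measure_pmf.prob (bind_pmf p g) X = measure_pmf.expectation p (\<lambda>x. measure_pmf.prob (g x) X)"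
  using expectation_bind_pmf[of "indicator X" 1 p g] by (simp add: indicator_def)

lemma integrable_pmf_bounded:
  fixes f :: "'b \<Rightarrow> real"
  assumes "\<And>y. y \<in> set_pmf p \<Longrightarrow> \<bar>f y\<bar> \<le> B"
  shows "integrable (measure_pmf p) f"
  using assms by (intro measure_pmf.integrable_const_bound[where B = B]) (auto simp: AE_measure_pmf_iff)

lemma bernoulli_pmf_clamp: "bernoulli_pmf (min 1 (max 0 r)) = bernoulli_pmf r"
  by (rule pmf_eqI) (simp add: bernoulli_pmf.rep_eq)

lemma set_pmf_bernoulli_iff:
  assumes "0 \<le> r" "r \<le> 1"
  shows "s \<in> set_pmf (bernoulli_pmf r) \<longleftrightarrow> (if s then r > 0 else r < 1)"
  using assms by (cases s) (auto simp: set_pmf_iff)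

lemma expectation_cong_pmf:
  assumes "\<And>x. x \<in> set_pmf p \<Longrightarrow> f x = (g x :: real)"
  shows "measure_pmf.expectation p f = measure_pmf.expectation p g"
  using assms by (intro integral_cong_AE) (auto simp: AE_measure_pmf_iff)


section \<open>Decision trees\<close>

lemma probed_simps [simp]:
  "probed [] = []" "probed (x # h) = fst x # probed h" "probed (h @ h') = probed h @ probed h'"
  by (simp_all add: probed_def)

lemma chosen_simps [simp]:
  "chosen [] = {}" "chosen ((e, s, a) # h) = (if a then insert e (chosen h) else chosen h)"
  "chosen (h @ h') = chosen h \<union> chosen h'"
  by (auto simp: chosen_def)

lemma chosen_subset_probed: "chosen h \<subseteq> set (probed h)"
  by (force simp: chosen_def probed_def)

lemma run_tree_Probe:
  "run_tree st (Probe e k0 k1) =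
     (if st e then bind_pmf k1 (\<lambda>(a, T). map_pmf (\<lambda>h. (e, True, a) # h) (run_tree st T))
      else bind_pmf k0 (\<lambda>T. map_pmf (\<lambda>h. (e, False, False) # h) (run_tree st T)))"
  by (auto simp: bind_map_pmf map_prod_def case_prod_beta intro!: bind_pmf_cong)

declare run_tree.simps(2) [simp del]

text \<open>Until the first probe on which \<open>st\<close> and \<open>st'\<close> differ the two
  runs coincide, so that this probe also occurs under \<open>st\<close>. Hence agreement on the
  edges probed under \<open>st\<close> alone is enough.\<close>

lemma run_tree_cong:
  assumes "\<And>h e. h \<in> set_pmf (run_tree st T) \<Longrightarrow> e \<in> set (probed h) \<Longrightarrow> st e = st' e"
  shows "run_tree st T = run_tree st' T"
  using assms
proof (induction T)
  case Halt
  show ?case by simp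
next
  case (Probe e k0 k1)
  have e: "st e = st' e"
  proof (cases "st e")
    case True
    obtain a T where aT: "(a, T) \<in> set_pmf k1" using set_pmf_not_empty[of k1] by fastforce
    obtain h where h: "h \<in> set_pmf (run_tree st T)" using set_pmf_not_empty by fast
    have "(e, True, a) # h \<in> set_pmf (run_tree st (Probe e k0 k1))"
      using True aT h by (force simp: run_tree_Probe)
    from Probe.prems[OF this, of e] show ?thesis by simp
  next
    case False
    obtain T where T: "T \<in> set_pmf k0" using set_pmf_not_empty[of k0] by fastforce
    obtain h where h: "h \<in> set_pmf (run_tree st T)" using set_pmf_not_empty by fast
    have "(e, False, False) # h \<in> set_pmf (run_tree st (Probe e k0 k1))"
      using False T h by (force simp: run_tree_Probe)
    from Probe.prems[OF this, of e] show ?thesis by simp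
  qed
  show ?case
  proof (cases "st e")
    case True
    have "run_tree st T = run_tree st' T" if aT: "(a, T) \<in> set_pmf k1" for a T
    proof (rule Probe.IH(2)[of "(a, T)" T])
      show "(a, T) \<in> set_pmf k1" "T \<in> Basic_BNFs.snds (a, T)" using aT by auto
      fix h f assume h: "h \<in> set_pmf (run_tree st T)" "f \<in> set (probed h)"
      have "(e, True, a) # h \<in> set_pmf (run_tree st (Probe e k0 k1))"
        using True aT h by (force simp: run_tree_Probe)
      from Probe.prems[OF this, of f] h show "st f = st' f" by simp
    qed
    with True e show ?thesis
      by (auto simp: run_tree_Probe intro!: bind_pmf_cong)
  next
    case False
    have "run_tree st T = run_tree st' T" if T: "T \<in> set_pmf k0" for T
    proof (rule Probe.IH(1)[OF T])
      fix h f assume h: "h \<in> set_pmf (run_tree st T)" "f \<in> set (probed h)"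
      have "(e, False, False) # h \<in> set_pmf (run_tree st (Probe e k0 k1))"
        using False T h by (force simp: run_tree_Probe)
      from Probe.prems[OF this, of f] h show "st f = st' f" by simp
    qed
    with False e show ?thesis
      by (auto simp: run_tree_Probe intro!: bind_pmf_cong)
  qed
qed

text \<open>The run in which the state of an edge is sampled only when the edge is probed.\<close>

primrec fresh_run :: "('e \<Rightarrow> real) \<Rightarrow> 'e ptree \<Rightarrow> 'e trace pmf" where
  "fresh_run p Halt = return_pmf []"
| "fresh_run p (Probe e k0 k1) =
     bind_pmf (map_pmf (map_prod id (fresh_run p)) k1) (\<lambda>(a, R).
     bind_pmf (bernoulli_pmf (p e)) (\<lambda>s.
       if s then map_pmf (\<lambda>h. (e, True, a) # h) R
       else bind_pmf (map_pmf (fresh_run p) k0) (map_pmf (\<lambda>h. (e, False, False) # h))))"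

lemma fresh_run_Probe:
  "fresh_run p (Probe e k0 k1) =
     bind_pmf k1 (\<lambda>(a, T). bind_pmf (bernoulli_pmf (p e)) (\<lambda>s.
       if s then map_pmf (\<lambda>h. (e, True, a) # h) (fresh_run p T)
       else bind_pmf k0 (\<lambda>T. map_pmf (\<lambda>h. (e, False, False) # h) (fresh_run p T))))"
  by (auto simp: bind_map_pmf map_prod_def case_prod_beta intro!: bind_pmf_cong)

declare fresh_run.simps(2) [simp del]

text \<open>Principle of deferred decisions: as no edge is probed twice, the state of the probed
  edge is independent of everything seen so far. In the induction the edge at the root leaves
  \<open>E\<close>, since its state can no longer influence the subtrees.\<close>

lemma presampled_states_eq_fresh_run:
  assumes "finite E"
    and "\<And>st h. st \<in> set_pmf (Pi_pmf E False (\<lambda>e. bernoulli_pmf (p e))) \<Longrightarrow>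
           h \<in> set_pmf (run_tree st T) \<Longrightarrow> distinct (probed h) \<and> set (probed h) \<subseteq> E"
  shows "bind_pmf (Pi_pmf E False (\<lambda>e. bernoulli_pmf (p e))) (\<lambda>st. run_tree st T) = fresh_run p T"
  using assms
proof (induction T arbitrary: E)
  case Halt
  show ?case by simp
next
  case (Probe e k0 k1)
  let ?P = "\<lambda>E. Pi_pmf E False (\<lambda>e. bernoulli_pmf (p e))"
  let ?T = "Probe e k0 k1"
  \<comment> \<open>The hypothesis speaks of traces only. Every run of the tree probes
    \<open>e\<close>, and some run exists, which puts \<open>e\<close> into
    \<open>E\<close>.\<close>
  have ex: "\<exists>h. h \<in> set_pmf (run_tree st ?T) \<and> e \<in> set (probed h)" for st
  proof -
    obtain h where h: "h \<in> set_pmf (run_tree st ?T)" using set_pmf_not_empty by fast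
    then have "e \<in> set (probed h)" by (auto simp: run_tree_Probe split: if_splits)
    with h show ?thesis by blast
  qed
  obtain st where "st \<in> set_pmf (?P E)" using set_pmf_not_empty by fast
  with ex[of st] Probe.prems(2)[of st] have "e \<in> E" by blast
  define E' where "E' = E - {e}"
  have E: "E = insert e E'" "e \<notin> E'" "finite E'" using \<open>e \<in> E\<close> Probe.prems(1) by (auto simp: E'_def)
  have supp: "f(e := s) \<in> set_pmf (?P E)"
    if "s \<in> set_pmf (bernoulli_pmf (p e))" "f \<in> set_pmf (?P E')" for s f
    using that unfolding E(1) by (subst Pi_pmf_insert[OF E(3,2)]) force
  \<comment> \<open>Prefixing a trace of the subtree with \<open>e\<close> gives a trace of the
    whole tree. So the subtree cannot probe \<open>e\<close> again and does not notice what its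
    state is set to.\<close>
  have 1: "run_tree (f(e := True)) T = run_tree f T \<and>
            (\<forall>h\<in>set_pmf (run_tree f T). distinct (probed h) \<and> set (probed h) \<subseteq> E')"
    if s: "True \<in> set_pmf (bernoulli_pmf (p e))" and f: "f \<in> set_pmf (?P E')"
      and T: "(a, T) \<in> set_pmf k1" for f a T
  proof -
    have *: "distinct (probed h) \<and> set (probed h) \<subseteq> E'"
      if h: "h \<in> set_pmf (run_tree (f(e := True)) T)" for h
    proof -
      have "(e, True, a) # h \<in> set_pmf (run_tree (f(e := True)) ?T)"
        using T h by (force simp: run_tree_Probe)
      from Probe.prems(2)[OF supp[OF s f] this] show ?thesis by (auto simp: E'_def)
    qed
    have "run_tree (f(e := True)) T = run_tree f T"
      by (rule run_tree_cong) (use * E(2) in auto)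
    with * show ?thesis by simp
  qed
  have 0: "run_tree (f(e := False)) T = run_tree f T \<and>
            (\<forall>h\<in>set_pmf (run_tree f T). distinct (probed h) \<and> set (probed h) \<subseteq> E')"
    if s: "False \<in> set_pmf (bernoulli_pmf (p e))" and f: "f \<in> set_pmf (?P E')"
      and T: "T \<in> set_pmf k0" for f T
  proof -
    have *: "distinct (probed h) \<and> set (probed h) \<subseteq> E'"
      if h: "h \<in> set_pmf (run_tree (f(e := False)) T)" for h
    proof -
      have "(e, False, False) # h \<in> set_pmf (run_tree (f(e := False)) ?T)"
        using T h by (force simp: run_tree_Probe)
      from Probe.prems(2)[OF supp[OF s f] this] show ?thesis by (auto simp: E'_def)
    qed
    have "run_tree (f(e := False)) T = run_tree f T"
      by (rule run_tree_cong) (use * E(2) in auto)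
    with * show ?thesis by simp
  qed
  have IH1: "bind_pmf (?P E') (\<lambda>f. run_tree (f(e := True)) T) = fresh_run p T"
    if "True \<in> set_pmf (bernoulli_pmf (p e))" "(a, T) \<in> set_pmf k1" for a T
  proof -
    have "bind_pmf (?P E') (\<lambda>f. run_tree (f(e := True)) T) = bind_pmf (?P E') (\<lambda>f. run_tree f T)"
      by (rule bind_pmf_cong) (use 1 that in auto)
    also have "\<dots> = fresh_run p T"
      by (rule Probe.IH(2)[of "(a, T)"]) (use 1 that E in auto)
    finally show ?thesis .
  qed
  have IH0: "bind_pmf (?P E') (\<lambda>f. run_tree (f(e := False)) T) = fresh_run p T"
    if "False \<in> set_pmf (bernoulli_pmf (p e))" "T \<in> set_pmf k0" for T
  proof -
    have "bind_pmf (?P E') (\<lambda>f. run_tree (f(e := False)) T) = bind_pmf (?P E') (\<lambda>f. run_tree f T)"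
      by (rule bind_pmf_cong) (use 0 that in auto)
    also have "\<dots> = fresh_run p T"
      by (rule Probe.IH(1)) (use 0 that E in auto)
    finally show ?thesis .
  qed
  have "bind_pmf (?P E) (\<lambda>st. run_tree st ?T) =
      bind_pmf (bernoulli_pmf (p e)) (\<lambda>s. bind_pmf (?P E') (\<lambda>f. run_tree (f(e := s)) ?T))"
    unfolding E(1) by (subst Pi_pmf_insert'[OF E(3,2)]) (simp add: bind_assoc_pmf bind_return_pmf)
  \<comment> \<open>The draw from \<open>k1\<close> is made for either state and ignored if
    \<open>e\<close> is inactive. This allows the decision to be drawn before the state, as in
    \<open>fresh_run\<close>.\<close>
  also have "\<dots> = bind_pmf (bernoulli_pmf (p e)) (\<lambda>s. bind_pmf k1 (\<lambda>(a, T).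
       if s then map_pmf (\<lambda>h. (e, True, a) # h) (fresh_run p T)
       else bind_pmf k0 (\<lambda>T. map_pmf (\<lambda>h. (e, False, False) # h) (fresh_run p T))))"
  proof (intro bind_pmf_cong refl)
    fix s assume s: "s \<in> set_pmf (bernoulli_pmf (p e))"
    show "bind_pmf (?P E') (\<lambda>f. run_tree (f(e := s)) ?T) = bind_pmf k1 (\<lambda>(a, T).
       if s then map_pmf (\<lambda>h. (e, True, a) # h) (fresh_run p T)
       else bind_pmf k0 (\<lambda>T. map_pmf (\<lambda>h. (e, False, False) # h) (fresh_run p T)))"
    proof (cases s)
      case True
      have "bind_pmf (?P E') (\<lambda>f. run_tree (f(e := s)) ?T) =
        bind_pmf k1 (\<lambda>aT. bind_pmf (?P E')
          (\<lambda>f. map_pmf (\<lambda>h. (e, True, fst aT) # h) (run_tree (f(e := True)) (snd aT))))"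
        using True by (subst bind_commute_pmf) (simp add: run_tree_Probe case_prod_unfold)
      also have "\<dots> = bind_pmf k1 (\<lambda>aT. map_pmf (\<lambda>h. (e, True, fst aT) # h) (fresh_run p (snd aT)))"
        using s True IH1 by (intro bind_pmf_cong refl) (auto simp flip: map_bind_pmf)
      finally show ?thesis using True by (simp add: case_prod_unfold)
    next
      case False
      have "bind_pmf (?P E') (\<lambda>f. run_tree (f(e := s)) ?T) =
        bind_pmf k0 (\<lambda>T. bind_pmf (?P E')
          (\<lambda>f. map_pmf (\<lambda>h. (e, False, False) # h) (run_tree (f(e := False)) T)))"
        using False by (subst bind_commute_pmf) (simp add: run_tree_Probe case_prod_unfold)
      also have "\<dots> = bind_pmf k0 (\<lambda>T. map_pmf (\<lambda>h. (e, False, False) # h) (fresh_run p T))"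
        using s False IH0 by (intro bind_pmf_cong refl) (auto simp flip: map_bind_pmf)
      finally show ?thesis using False by (simp add: case_prod_unfold)
    qed
  qed
  also have "\<dots> = fresh_run p ?T"
    unfolding fresh_run_Probe by (subst bind_commute_pmf) (simp add: case_prod_unfold)
  finally show ?case .
qed

section \<open>Committed strings\<close>

definition miss_prob :: "('e \<Rightarrow> real) \<Rightarrow> 'e list \<Rightarrow> real" where
  "miss_prob p es = (\<Prod>e\<leftarrow>es. 1 - p e)"

text \<open>The probability that probing \<open>es\<close> until the first active edge reaches
  \<open>f\<close>. The value 0 off the string lets the LP sums over strings containing
  \<open>f\<close> run over all strings.\<close>

definition reach_prob :: "('e \<Rightarrow> real) \<Rightarrow> 'e \<Rightarrow> 'e list \<Rightarrow> real" where
  "reach_prob p f es = (if f \<in> set es then miss_prob p (before f es) else 0)"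

lemma reach_prob_simps [simp]:
  "reach_prob p f [] = 0"
  "reach_prob p f (e # es) = (if f = e then 1 else (1 - p e) * reach_prob p f es)"
  by (auto simp: reach_prob_def miss_prob_def before_def)

lemma reach_prob_range:
  assumes "\<And>e. 0 \<le> p e \<and> p e \<le> 1"
  shows "0 \<le> reach_prob p f es \<and> reach_prob p f es \<le> 1"
  using assms by (induction es) (auto intro: mult_le_one)

text \<open>
  The edges of \<open>v\<close> that a tree probes with the intention to accept, when these probes are forced to
  fail. For \<open>p e = 1\<close> the continuation after a failed probe lies outside the support of any actual run, so
  nothing is known about its feasibility; it is cut off, at no cost since it is reached with probability 0.
\<close>

primrec committed_string ::
    "('u \<times> 'v \<Rightarrow> real) \<Rightarrow> 'v \<Rightarrow> ('u \<times> 'v) ptree \<Rightarrow> ('u \<times> 'v) list pmf" where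
  "committed_string p v Halt = return_pmf []"
| "committed_string p v (Probe e k0 k1) =
     bind_pmf (map_pmf (map_prod id (committed_string p v)) k1) (\<lambda>(a, R).
       if snd e = v \<and> a
       then if p e = 1 then return_pmf [e]
            else bind_pmf (map_pmf (committed_string p v) k0) (map_pmf (\<lambda>es. e # es))
       else bind_pmf (bernoulli_pmf (p e)) (\<lambda>s.
              if s then R else bind_pmf (map_pmf (committed_string p v) k0) id))"

lemma committed_string_Probe:
  "committed_string p v (Probe e k0 k1) =
     bind_pmf k1 (\<lambda>(a, T).
       if snd e = v \<and> a
       then if p e = 1 then return_pmf [e]
            else bind_pmf k0 (\<lambda>T. map_pmf (\<lambda>es. e # es) (committed_string p v T))
       else bind_pmf (bernoulli_pmf (p e)) (\<lambda>s.
              if s then committed_string p v T else bind_pmf k0 (committed_string p v)))"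
  by (simp add: bind_map_pmf map_prod_def case_prod_unfold cong: if_cong)

declare committed_string.simps(2) [simp del]

text \<open>Together with its counterpart for an inactive edge, this carries assumptions on the
  traces of a tree over to its subtrees, along branches of positive probability.\<close>

lemma active_in_fresh_run:
  assumes "0 \<le> p e \<and> p e \<le> 1" "(a, T) \<in> set_pmf k1" "p e > 0" "h \<in> set_pmf (fresh_run p T)"
  shows "(e, True, a) # h \<in> set_pmf (fresh_run p (Probe e k0 k1))"
proof -
  have "True \<in> set_pmf (bernoulli_pmf (p e))" using assms by (simp add: set_pmf_bernoulli_iff)
  with assms(2,4) show ?thesis
    unfolding fresh_run_Probe set_bind_pmf by (intro UN_I[of "(a, T)"]) (auto intro!: bexI[of _ True])
qed

lemma inactive_in_fresh_run:
  assumes "0 \<le> p e \<and> p e \<le> 1" "T \<in> set_pmf k0" "p e < 1" "h \<in> set_pmf (fresh_run p T)"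
  shows "(e, False, False) # h \<in> set_pmf (fresh_run p (Probe e k0 k1))"
proof -
  obtain aT where "aT \<in> set_pmf k1" using set_pmf_not_empty by fast
  moreover have "False \<in> set_pmf (bernoulli_pmf (p e))" using assms by (simp add: set_pmf_bernoulli_iff)
  ultimately show ?thesis using assms(2,4)
    unfolding fresh_run_Probe set_bind_pmf
    by (intro UN_I[of aT]) (auto simp: case_prod_unfold intro!: bexI[of _ False])
qed

text \<open>A forced failure of an edge with \<open>p e < 1\<close> is a possible event, and the
  coin that simulates any other probe takes only values that the true state can take. So each string
  sits inside some actual trace, which is what ties it to the probing constraint.\<close>

lemma committed_string_subseq:
  assumes p: "\<And>e. 0 \<le> p e \<and> p e \<le> 1" and "es \<in> set_pmf (committed_string p v T)"
  shows "\<exists>h\<in>set_pmf (fresh_run p T). subseq es (filter (\<lambda>e. snd e = v) (probed h))"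
  using assms(2)
proof (induction T arbitrary: es)
  case Halt
  then show ?case by simp
next
  case (Probe e k0 k1)
  let ?fl = "\<lambda>h. filter (\<lambda>e. snd e = v) (probed h)"
  note act = active_in_fresh_run[of p e, OF p]
  note inact = inactive_in_fresh_run[of p e, OF p]
  obtain a T where aT: "(a, T) \<in> set_pmf k1"
    and es: "es \<in> set_pmf (if snd e = v \<and> a
       then if p e = 1 then return_pmf [e]
            else bind_pmf k0 (\<lambda>T. map_pmf (\<lambda>es. e # es) (committed_string p v T))
       else bind_pmf (bernoulli_pmf (p e)) (\<lambda>s.
              if s then committed_string p v T else bind_pmf k0 (committed_string p v)))"
    using Probe.prems by (auto simp: committed_string_Probe)
  show ?case
  proof (cases "snd e = v \<and> a")
    case True
    show ?thesis
    proof (cases "p e = 1")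
      case p1: True
      \<comment> \<open>The string ends at \<open>e\<close>, so any continuation after an active
        \<open>e\<close> serves as the trace.\<close>
      obtain h where "h \<in> set_pmf (fresh_run p T)" using set_pmf_not_empty by fast
      from act[OF aT _ this] p1 True es show ?thesis by (intro bexI) auto
    next
      case False
      then obtain T0 es' where T0: "T0 \<in> set_pmf k0" "es' \<in> set_pmf (committed_string p v T0)"
        "es = e # es'" using es True by auto
      from Probe.IH(1)[OF T0(1,2)] obtain h where h: "h \<in> set_pmf (fresh_run p T0)"
        "subseq es' (?fl h)" by blast
      have "p e < 1" using False p[of e] by simp
      from inact[OF T0(1) this h(1)] h(2) T0(3) True show ?thesis by (intro bexI) auto
    qed
  next
    case False
    then obtain s where s: "s \<in> set_pmf (bernoulli_pmf (p e))"
      "es \<in> set_pmf (if s then committed_string p v T else bind_pmf k0 (committed_string p v))"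
      using es[unfolded if_not_P[OF False] set_bind_pmf] by blast
    show ?thesis
    proof (cases s)
      case s1: True
      from Probe.IH(2)[OF aT, of T es] s s1 obtain h where h: "h \<in> set_pmf (fresh_run p T)"
        "subseq es (?fl h)" by auto
      have "p e > 0" using s s1 p[of e] by (simp add: set_pmf_bernoulli_iff)
      from act[OF aT this h(1)] h(2) show ?thesis
        by (intro bexI[of _ "(e, True, a) # h"]) auto
    next
      case s0: False
      then obtain T0 where T0: "T0 \<in> set_pmf k0" "es \<in> set_pmf (committed_string p v T0)"
        using s by auto
      from Probe.IH(1)[OF T0] obtain h where h: "h \<in> set_pmf (fresh_run p T0)"
        "subseq es (?fl h)" by blast
      have "p e < 1" using s s0 p[of e] by (simp add: set_pmf_bernoulli_iff)
      from inact[OF T0(1) this h(1)] h(2) show ?thesis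
        by (intro bexI[of _ "(e, False, False) # h"]) auto
    qed
  qed
qed

text \<open>After a committed probe of another edge of the same vertex, \<open>f\<close> can be
  chosen only if that probe fails, because the outcome is a matching; this is the factor
  \<open>1 - p e\<close> in \<open>reach_prob\<close>. At a probe without commitment, or at another
  vertex, both continuations contribute, and the coin in \<open>committed_string\<close> reproduces
  the average over the state.\<close>

lemma prob_chosen_eq:
  assumes p: "\<And>e. 0 \<le> p e \<and> p e \<le> 1"
    and "\<And>h. h \<in> set_pmf (fresh_run p T) \<Longrightarrow> distinct (probed h) \<and> matching (chosen h)"
  shows "measure_pmf.prob (fresh_run p T) {h. f \<in> chosen h} =
         p f * measure_pmf.expectation (committed_string p (snd f) T) (reach_prob p f)"
  using assms(2)
proof (induction T)
  case Halt
  show ?case by simp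
next
  case (Probe e k0 k1)
  define v where "v = snd f"
  define M where "M T = measure_pmf.prob (fresh_run p T) {h. f \<in> chosen h}" for T
  define R where "R = (\<lambda>T. measure_pmf.expectation (committed_string p v T) (reach_prob p f))"
  define M0 where "M0 = measure_pmf.expectation k0 M"
  define R0 where "R0 = measure_pmf.expectation k0 R"
  have bnd: "\<bar>reach_prob p f es\<bar> \<le> 1" for es using reach_prob_range[OF p, where f = f and es = es] by simp
  have act: "distinct (e # probed h) \<and> matching (if a then insert e (chosen h) else chosen h)"
    if "(a, T) \<in> set_pmf k1" "p e > 0" "h \<in> set_pmf (fresh_run p T)" for a T h
  proof -
    from Probe.prems[OF active_in_fresh_run[OF p that]] show ?thesis by (auto split: if_splits)
  qed
  have inact: "distinct (e # probed h) \<and> matching (chosen h)"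
    if "T \<in> set_pmf k0" "p e < 1" "h \<in> set_pmf (fresh_run p T)" for T h
  proof -
    from Probe.prems[OF inactive_in_fresh_run[OF p that]] show ?thesis by auto
  qed
  \<comment> \<open>The induction hypotheses are available only on branches of positive probability;
    the factors \<open>p e\<close> and \<open>1 - p e\<close> make the equations trivial on the
    others.\<close>
  have M1: "p e * M T = p e * (p f * R T)" if "(a, T) \<in> set_pmf k1" for a T
  proof (cases "p e > 0")
    case True
    have "M T = p f * R T" unfolding M_def R_def v_def
      by (rule Probe.IH(2)[of "(a, T)"])
         (use that act[OF that True] in \<open>auto simp: matching_def split: if_splits\<close>)
    then show ?thesis by simp
  qed (use p[of e] in auto)
  have M0: "(1 - p e) * M0 = (1 - p e) * (p f * R0)"
  proof (cases "p e < 1")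
    case True
    have "M T = p f * R T" if "T \<in> set_pmf k0" for T unfolding M_def R_def v_def
      by (rule Probe.IH(1)) (use that inact[OF that True] in auto)
    then have "M0 = measure_pmf.expectation k0 (\<lambda>T. p f * R T)"
      unfolding M0_def by (rule expectation_cong_pmf)
    then show ?thesis by (simp add: R0_def)
  qed (use p[of e] in auto)
  have never: "M T = 0" if "\<And>h. h \<in> set_pmf (fresh_run p T) \<Longrightarrow> f \<notin> chosen h" for T
    unfolding M_def using that by (subst measure_pmf_zero_iff) auto
  \<comment> \<open>A probed edge is not probed again, hence not chosen later.\<close>
  have M1_eq: "p e * M T = 0" if "(a, T) \<in> set_pmf k1" "f = e" for a T
  proof (cases "p e > 0")
    case True
    have "f \<notin> chosen h" if "h \<in> set_pmf (fresh_run p T)" for h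
      using act[OF \<open>(a, T) \<in> set_pmf k1\<close> True that] chosen_subset_probed[of h] \<open>f = e\<close> by auto
    from never[OF this] show ?thesis by simp
  qed (use p[of e] in auto)
  \<comment> \<open>The accepted edge \<open>e\<close> already occupies \<open>v\<close>, which
    excludes \<open>f\<close>.\<close>
  have M1_v: "p e * M T = 0" if "(True, T) \<in> set_pmf k1" "f \<noteq> e" "snd e = v" for T
  proof (cases "p e > 0")
    case True
    have "f \<notin> chosen h" if "h \<in> set_pmf (fresh_run p T)" for h
      using act[OF \<open>(True, T) \<in> set_pmf k1\<close> True that] \<open>f \<noteq> e\<close> \<open>snd e = v\<close>
      by (auto simp: matching_def v_def)
    from never[OF this] show ?thesis by simp
  qed (use p[of e] in auto)
  have M0_eq: "(1 - p e) * M0 = 0" if "f = e"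
  proof (cases "p e < 1")
    case True
    have "M T = 0" if "T \<in> set_pmf k0" for T
    proof (rule never)
      show "f \<notin> chosen h" if "h \<in> set_pmf (fresh_run p T)" for h
        using inact[OF \<open>T \<in> set_pmf k0\<close> True that] chosen_subset_probed[of h] \<open>f = e\<close> by auto
    qed
    then have "M0 = measure_pmf.expectation k0 (\<lambda>_. 0)"
      unfolding M0_def by (rule expectation_cong_pmf)
    then show ?thesis by simp
  qed (use p[of e] in auto)
  have R_bind: "measure_pmf.expectation (bind_pmf q g) (reach_prob p f) =
      measure_pmf.expectation q (\<lambda>x. measure_pmf.expectation (g x) (reach_prob p f))" for q :: "'x pmf" and g
    by (rule expectation_bind_pmf[OF bnd])
  have R_cons: "measure_pmf.expectation (map_pmf ((#) e) q) (reach_prob p f) =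
      (if f = e then 1 else (1 - p e) * measure_pmf.expectation q (reach_prob p f))" for q
    by simp
  have "measure_pmf.prob (fresh_run p (Probe e k0 k1)) {h. f \<in> chosen h} =
    measure_pmf.expectation k1 (\<lambda>(a, T). p e * (if a \<and> f = e then 1 else M T) + (1 - p e) * M0)"
    unfolding fresh_run_Probe
    by (auto simp: prob_bind_pmf case_prod_unfold p M_def M0_def vimage_def mult.commute
             intro!: expectation_cong_pmf)
  also have "\<dots> = measure_pmf.expectation k1 (\<lambda>(a, T). p f *
      (if snd e = v \<and> a then if f = e then 1 else (1 - p e) * R0 else p e * R T + (1 - p e) * R0))"
  proof (intro expectation_cong_pmf, clarify)
    fix a T assume aT: "(a, T) \<in> set_pmf k1"
    show "p e * (if a \<and> f = e then 1 else M T) + (1 - p e) * M0 = p f *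
      (if snd e = v \<and> a then if f = e then 1 else (1 - p e) * R0 else p e * R T + (1 - p e) * R0)"
    proof -
      have R: "p f * (p e * R T) = p e * M T" "p f * ((1 - p e) * R0) = (1 - p e) * M0"
        using M1[OF aT] M0 by auto
      have "p f * (if snd e = v \<and> a then if f = e then 1 else (1 - p e) * R0
                   else p e * R T + (1 - p e) * R0) =
            (if snd e = v \<and> a then if f = e then p f else (1 - p e) * M0
             else p e * M T + (1 - p e) * M0)"
        by (simp only: if_distrib[of "\<lambda>x. p f * x"] distrib_left R mult_1_right)
      also have "\<dots> = p e * (if a \<and> f = e then 1 else M T) + (1 - p e) * M0"
      proof (cases "f = e")
        case True
        then have "snd e = v" by (simp add: v_def)
        with M1_eq[OF aT True] M0_eq[OF True] True show ?thesis by (cases a) simp_all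
      next
        case False
        with M1_v[of T] aT show ?thesis by (cases a; cases "snd e = v") simp_all
      qed
      finally show ?thesis ..
    qed
  qed
  also have "\<dots> = p f * measure_pmf.expectation (committed_string p v (Probe e k0 k1)) (reach_prob p f)"
  proof -
    have accept: "measure_pmf.expectation
          (bind_pmf k0 (\<lambda>T. map_pmf (\<lambda>es. e # es) (committed_string p v T))) (reach_prob p f) =
        (if f = e then 1 else (1 - p e) * R0)"
      unfolding R_bind R_cons by (simp add: R_def R0_def)
    have continue: "measure_pmf.expectation (bind_pmf (bernoulli_pmf (p e)) (\<lambda>s.
          if s then committed_string p v T else bind_pmf k0 (committed_string p v))) (reach_prob p f) =
        p e * R T + (1 - p e) * R0" for T
      unfolding R_bind by (simp add: p R_bind R_def R0_def mult.commute)
    \<comment> \<open>If \<open>p e = 1\<close>, the truncated string \<open>[e]\<close> gives the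
      same value, because the factor \<open>1 - p e\<close> vanishes.\<close>
    have "measure_pmf.expectation (committed_string p v (Probe e k0 k1)) (reach_prob p f) =
      measure_pmf.expectation k1 (\<lambda>(a, T).
       if snd e = v \<and> a then if f = e then 1 else (1 - p e) * R0 else p e * R T + (1 - p e) * R0)"
      unfolding committed_string_Probe R_bind[of k1]
      by (intro expectation_cong_pmf)
         (simp only: case_prod_unfold accept continue
            if_distrib[of "\<lambda>q. measure_pmf.expectation q (reach_prob p f)"], simp)
    then show ?thesis by (simp add: case_prod_unfold)
  qed
  finally show ?case by (simp add: v_def)
qed

section \<open>The configuration LP relaxes the offline problem\<close>

text \<open>Clamped as in \<open>bernoulli_pmf\<close>, to be a probability also outside the edge set.\<close>

definition edge_prob :: "('u, 'v) sgraph \<Rightarrow> 'u \<times> 'v \<Rightarrow> real" where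
  "edge_prob G e = min 1 (max 0 (pr G e))"

lemma edge_prob_range: "0 \<le> edge_prob G e \<and> edge_prob G e \<le> 1"
  by (simp add: edge_prob_def)

lemma bernoulli_edge_prob: "bernoulli_pmf (edge_prob G e) = bernoulli_pmf (pr G e)"
  by (simp add: edge_prob_def bernoulli_pmf_clamp)

section \<open>Strings in the type graph and in its instances\<close>

lemma instantiate_simps [simp]:
  "off (instantiate H n \<tau>) = off H" "onl (instantiate H n \<tau>) = {1..n}"
  "wt (instantiate H n \<tau>) (u, i) = wt H (u, \<tau> i)"
  "pr (instantiate H n \<tau>) (u, i) = pr H (u, \<tau> i)"
  "con (instantiate H n \<tau>) i = map (\<lambda>(u, b). (u, i)) ` con H (\<tau> i)"
  by (simp_all add: instantiate_def)

lemma con_string: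
  assumes "stochastic_graph H" "b \<in> onl H" "es \<in> con H b"
  shows "distinct es" "set es \<subseteq> off H \<times> {b}"
  using assms by (auto simp: stochastic_graph_def strings_def star_def)

text \<open>Downward closure speaks of contiguous pieces and permutations. A subsequence is obtained
  by moving the discarded edges to the end and then taking a prefix.\<close>

lemma con_subseq:
  assumes "stochastic_graph H" "b \<in> onl H" "es \<in> con H b" "subseq fs es"
  shows "fs \<in> con H b"
proof -
  have dc: "downward_closed (con H b)" using assms by (simp add: stochastic_graph_def)
  have "mset fs \<subseteq># mset es"
    using assms(4) by (induction rule: list_emb.induct) (auto intro: subset_mset.order_trans)
  then obtain M where "mset es = mset fs + M" by (auto simp: subset_mset.le_iff_add)
  moreover obtain gs where "mset gs = M" using ex_mset by blast
  ultimately have "mset (fs @ gs) = mset es" by simp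
  then have "fs @ gs \<in> con H b" using dc assms(3) unfolding downward_closed_def by blast
  moreover have "sublist fs (fs @ gs)" by (rule prefix_imp_sublist) simp
  ultimately show ?thesis using dc unfolding downward_closed_def by blast
qed

lemma pr_range:
  assumes "stochastic_graph H" "u \<in> off H" "b \<in> onl H"
  shows "0 \<le> pr H (u, b) \<and> pr H (u, b) \<le> 1"
  using assms by (auto simp: stochastic_graph_def edges_def)

lemma wt_nonneg:
  assumes "stochastic_graph H" "u \<in> off H" "b \<in> onl H"
  shows "0 \<le> wt H (u, b)"
  using assms by (auto simp: stochastic_graph_def edges_def)

lemma gprob_eq_miss_prob: "gprob H = miss_prob (pr H)"
  by (simp add: fun_eq_iff gprob_def miss_prob_def)

lemma sum_containing_strings:
  assumes "finite C"
  shows "(\<Sum>es\<in>{es\<in>C. f \<in> set es}. c * gprob H (before f es) * y es) =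
         (\<Sum>es\<in>C. c * reach_prob (pr H) f es * y es)"
  using assms by (intro sum.mono_neutral_cong_left) (auto simp: reach_prob_def gprob_eq_miss_prob)

text \<open>The expected weight of the first active edge, split according to which edge it is:
  \<open>f\<close> is reached and active with probability
  \<open>pr H f * reach_prob (pr H) f es\<close>.\<close>

lemma val_eq_sum_reach_prob:
  assumes H: "stochastic_graph H" "b \<in> onl H" "es \<in> con H b"
  shows "val H es = (\<Sum>u\<in>off H. pr H (u, b) * wt H (u, b) * reach_prob (pr H) (u, b) es)"
proof -
  have "val H es = (\<Sum>e\<in>set es. pr H e * wt H e * gprob H (before e es))"
    using con_string[OF H] by (simp add: val_def sum_list_distinct_conv_sum_set)
  also have "\<dots> = (\<Sum>e\<in>off H \<times> {b}. pr H e * wt H e * reach_prob (pr H) e es)"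
    using con_string[OF H] H(1)
    by (intro sum.mono_neutral_cong_left)
       (auto simp: reach_prob_def gprob_eq_miss_prob stochastic_graph_def)
  also have "\<dots> = (\<Sum>u\<in>off H. pr H (u, b) * wt H (u, b) * reach_prob (pr H) (u, b) es)"
    by (simp add: sum.cartesian_product')
  finally show ?thesis .
qed

text \<open>The constraints control probes vertex by vertex. A repetition in the whole sequence
  would already be one among the probes of a single vertex.\<close>

lemma distinct_if_distinct_fibres:
  assumes "\<And>v. v \<in> f ` set xs \<Longrightarrow> distinct (filter (\<lambda>e. f e = v) xs)"
  shows "distinct xs"
  using assms
proof (induction xs)
  case (Cons x xs)
  have "distinct (filter (\<lambda>e. f e = v) xs)" if "v \<in> f ` set xs" for v
    using Cons.prems[of v] that by (auto split: if_splits)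
  moreover have "x \<notin> set xs" using Cons.prems[of "f x"] by auto
  ultimately show ?case using Cons.IH by simp
qed simp

lemma expectation_trace_weight:
  assumes "finite (edges G)" "\<And>h. h \<in> set_pmf R \<Longrightarrow> chosen h \<subseteq> edges G"
  shows "measure_pmf.expectation R (trace_weight G) =
         (\<Sum>f\<in>edges G. wt G f * measure_pmf.prob R {h. f \<in> chosen h})"
proof -
  have "measure_pmf.expectation R (trace_weight G) =
        measure_pmf.expectation R (\<lambda>h. \<Sum>f\<in>edges G. wt G f * indicator {h. f \<in> chosen h} h)"
  proof (rule expectation_cong_pmf)
    fix h assume "h \<in> set_pmf R"
    with assms show "trace_weight G h = (\<Sum>f\<in>edges G. wt G f * indicator {h. f \<in> chosen h} h)"
      unfolding trace_weight_def by (intro sum.mono_neutral_cong_left) auto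
  qed
  also have "\<dots> = (\<Sum>f\<in>edges G. wt G f * measure_pmf.prob R {h. f \<in> chosen h})"
    by (subst Bochner_Integration.integral_sum)
       (auto intro!: integrable_pmf_bounded[where B = 1] split: split_indicator)
  finally show ?thesis .
qed

text \<open>The sum is the expected number of matched edges at \<open>u\<close>; it becomes the LP
  constraint of \<open>u\<close>.\<close>

lemma sum_prob_chosen_le_1:
  assumes "\<And>h. h \<in> set_pmf R \<Longrightarrow> matching (chosen h)" "finite I"
  shows "(\<Sum>i\<in>I. measure_pmf.prob R {h. (u, i) \<in> chosen h}) \<le> 1"
proof -
  have "(\<Sum>i\<in>I. measure_pmf.prob R {h. (u, i) \<in> chosen h}) =
        measure_pmf.expectation R (\<lambda>h. \<Sum>i\<in>I. indicator {h. (u, i) \<in> chosen h} h)"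
    by (subst Bochner_Integration.integral_sum)
       (auto intro!: integrable_pmf_bounded[where B = 1] simp: indicator_def)
  also have "\<dots> \<le> measure_pmf.expectation R (\<lambda>_. 1)"
  proof (intro integral_mono_AE)
    have "(\<Sum>i\<in>I. indicator {h. (u, i) \<in> chosen h} h :: real) \<le> 1" if "h \<in> set_pmf R" for h
    proof -
      have "(\<Sum>i\<in>I. indicator {h. (u, i) \<in> chosen h} h :: real) =
          of_nat (card {i\<in>I. (u, i) \<in> chosen h})"
        using assms(2) by (simp add: indicator_def sum.If_cases Int_def)
      moreover have "card {i\<in>I. (u, i) \<in> chosen h} \<le> 1"
        using assms(1)[OF that] assms(2)
        by (simp add: card_le_Suc0_iff_eq matching_def) (metis fst_conv snd_conv)
      ultimately show ?thesis by simp
    qed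
    then show "AE h in measure_pmf R. (\<Sum>i\<in>I. indicator {h. (u, i) \<in> chosen h} h) \<le> (1 :: real)"
      by (simp add: AE_measure_pmf_iff)
    show "integrable (measure_pmf R) (\<lambda>h. \<Sum>i\<in>I. indicator {h. (u, i) \<in> chosen h} h :: real)"
      by (intro Bochner_Integration.integrable_sum integrable_pmf_bounded[where B = 1])
         (simp add: indicator_def)
  qed simp
  finally show ?thesis by simp
qed

text \<open>Allowed strings have no repetitions, so a feasible algorithm never probes an edge twice
  and deferred sampling applies. The second claim carries feasibility over to the fresh
  runs.\<close>

lemma offline_run_eq_fresh_run:
  assumes fin: "finite (edges G)"
    and con: "\<forall>v\<in>onl G. con G v \<subseteq> Collect distinct"
    and A: "A \<in> offline_algorithms G"
  shows "offline_run G A = bind_pmf A (fresh_run (edge_prob G))"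
    and "T \<in> set_pmf A \<Longrightarrow> h \<in> set_pmf (fresh_run (edge_prob G) T) \<Longrightarrow>
           distinct (probed h) \<and> feasible_trace G h"
proof -
  let ?P = "Pi_pmf (edges G) False (\<lambda>e. bernoulli_pmf (edge_prob G e))"
  have states: "states_pmf G = ?P" by (simp add: states_pmf_def bernoulli_edge_prob)
  have ok: "distinct (probed h) \<and> feasible_trace G h"
    if "T \<in> set_pmf A" "st \<in> set_pmf ?P" "h \<in> set_pmf (run_tree st T)" for T st h
  proof -
    have "h \<in> set_pmf (offline_run G A)" using that by (auto simp: offline_run_def states)
    then have h: "feasible_trace G h" using A by (auto simp: offline_algorithms_def)
    moreover have "distinct (probed h)"
    proof (rule distinct_if_distinct_fibres[of snd])
      fix v assume "v \<in> snd ` set (probed h)"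
      then have "v \<in> onl G" using h by (auto simp: feasible_trace_def edges_def)
      then show "distinct (filter (\<lambda>e. snd e = v) (probed h))"
        using h con unfolding feasible_trace_def by blast
    qed
    ultimately show ?thesis by simp
  qed
  have fresh: "bind_pmf ?P (\<lambda>st. run_tree st T) = fresh_run (edge_prob G) T" if "T \<in> set_pmf A" for T
    by (rule presampled_states_eq_fresh_run[OF fin])
       (use ok[OF that] in \<open>auto simp: feasible_trace_def\<close>)
  show "offline_run G A = bind_pmf A (fresh_run (edge_prob G))"
    unfolding offline_run_def states
    by (subst bind_commute_pmf) (intro bind_pmf_cong refl fresh)
  show "distinct (probed h) \<and> feasible_trace G h"
    if T: "T \<in> set_pmf A" and h: "h \<in> set_pmf (fresh_run (edge_prob G) T)"
    using h ok[OF T] unfolding fresh[OF T, symmetric] by auto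
qed

text \<open>All edges of the string belong to one vertex, so exchanging its index for its type is
  injective on them and preserves the probabilities.\<close>

lemma reach_prob_instantiate:
  assumes "stochastic_graph H" "b \<in> onl H" "set es \<subseteq> off H \<times> {b}" and "\<tau> i = b"
  shows "reach_prob (edge_prob (instantiate H n \<tau>)) (u, i) (map (\<lambda>(u, b). (u, i)) es) =
         reach_prob (pr H) (u, b) es"
  using assms(3)
proof (induction es)
  case (Cons e es)
  then show ?case using pr_range[OF assms(1) _ assms(2)] assms(4)
    by (auto simp: edge_prob_def)
qed simp

text \<open>The witness \<open>Y i\<close> is the law of the committed string of vertex
  \<open>i\<close> for the given types. Load and value are linear in these marginals, whatever their
  joint law.\<close>

lemma offline_algorithm_configuration:
  fixes H :: "('u, 'b) sgraph" and n :: nat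
  defines "G \<equiv> \<lambda>\<tau>. instantiate H n \<tau>"
  assumes H: "stochastic_graph H" and \<tau>: "\<And>i. i \<in> {1..n} \<Longrightarrow> \<tau> i \<in> onl H"
    and A: "A \<in> offline_algorithms (G \<tau>)"
  shows "\<exists>Y. (\<forall>i\<in>{1..n}. set_pmf (Y i) \<subseteq> con H (\<tau> i)) \<and>
    (\<forall>u\<in>off H. (\<Sum>i=1..n. \<Sum>es\<in>con H (\<tau> i).
       pr H (u, \<tau> i) * reach_prob (pr H) (u, \<tau> i) es * pmf (Y i) es) \<le> 1) \<and>
    measure_pmf.expectation (offline_run (G \<tau>) A) (trace_weight (G \<tau>)) =
      (\<Sum>i=1..n. \<Sum>es\<in>con H (\<tau> i). val H es * pmf (Y i) es)"
proof -
  let ?G = "G \<tau>" and ?p = "edge_prob (G \<tau>)"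
  have fin: "finite (edges ?G)" "finite (off H)"
    using H by (auto simp: G_def edges_def stochastic_graph_def)
  have con: "\<forall>v\<in>onl ?G. con ?G v \<subseteq> Collect distinct"
  proof
    fix v assume v: "v \<in> onl ?G"
    have "distinct (map (\<lambda>(u, b). (u, v)) es)" if es: "es \<in> con H (\<tau> v)" for es
      using con_string[OF H \<tau> es] v
      by (auto simp: G_def distinct_map inj_on_def)
    then show "con ?G v \<subseteq> Collect distinct" by (auto simp: G_def)
  qed
  note run = offline_run_eq_fresh_run[OF fin(1) con A]
  \<comment> \<open>\<open>W v\<close> also averages over the tree drawn by a randomized algorithm;
    \<open>Y\<close> renames its strings to edges of the type graph.\<close>
  define W where "W v = bind_pmf A (committed_string ?p v)" for v
  define Y where "Y i = map_pmf (map (\<lambda>(u, _). (u, \<tau> i))) (W i)" for i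
  have W: "\<exists>l\<in>con H (\<tau> i). es = map (\<lambda>(u, b). (u, i)) l"
    if i: "i \<in> {1..n}" and es: "es \<in> set_pmf (W i)" for i es
  proof -
    obtain T where T: "T \<in> set_pmf A" "es \<in> set_pmf (committed_string ?p i T)"
      using es by (auto simp: W_def)
    obtain h where h: "h \<in> set_pmf (fresh_run ?p T)"
      "subseq es (filter (\<lambda>e. snd e = i) (probed h))"
      using committed_string_subseq[OF edge_prob_range T(2)] by blast
    have "filter (\<lambda>e. snd e = i) (probed h) \<in> con ?G i"
      using run(2)[OF T(1) h(1)] i by (auto simp: feasible_trace_def G_def)
    then obtain l where l: "l \<in> con H (\<tau> i)" "subseq es (map (\<lambda>(u, b). (u, i)) l)"
      using h(2) by (auto simp: G_def)
    \<comment> \<open>Taking subsequences commutes with renaming, so \<open>es\<close> is the image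
      of a subsequence of \<open>l\<close>, to which downward closure applies.\<close>
    then obtain N where "es = map (\<lambda>(u, b). (u, i)) (nths l N)"
      by (auto simp: subseq_conv_nths nths_map)
    moreover have "nths l N \<in> con H (\<tau> i)"
      by (rule con_subseq[OF H \<tau>[OF i] l(1)]) (auto simp: subseq_conv_nths)
    ultimately show ?thesis by blast
  qed
  have typed: "map (\<lambda>(u, _). (u, \<tau> i)) (map (\<lambda>(u, b). (u, i)) l) = l"
    if "i \<in> {1..n}" "l \<in> con H (\<tau> i)" for i l
    using con_string(2)[OF H \<tau>[OF that(1)] that(2)] by (auto intro!: map_idI)
  have Y: "set_pmf (Y i) \<subseteq> con H (\<tau> i)" if i: "i \<in> {1..n}" for i
  proof
    fix l' assume "l' \<in> set_pmf (Y i)"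
    then obtain es where es: "es \<in> set_pmf (W i)" "l' = map (\<lambda>(u, _). (u, \<tau> i)) es"
      by (auto simp: Y_def)
    obtain l where l: "l \<in> con H (\<tau> i)" "es = map (\<lambda>(u, b). (u, i)) l"
      using W[OF i es(1)] by blast
    have "l' = l" unfolding es(2) l(2) by (rule typed[OF i l(1)])
    with l(1) show "l' \<in> con H (\<tau> i)" by simp
  qed
  have prob: "measure_pmf.prob (offline_run ?G A) {h. (u, i) \<in> chosen h} =
      (\<Sum>es\<in>con H (\<tau> i). pr H (u, \<tau> i) * reach_prob (pr H) (u, \<tau> i) es * pmf (Y i) es)"
    if u: "u \<in> off H" and i: "i \<in> {1..n}" for u i
  proof -
    have bnd: "\<bar>reach_prob ?p (u, i) es\<bar> \<le> 1" for es
      using reach_prob_range[of ?p "(u, i)" es, OF edge_prob_range] by simp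
    have "measure_pmf.prob (offline_run ?G A) {h. (u, i) \<in> chosen h} =
        measure_pmf.expectation A (\<lambda>T. ?p (u, i) *
          measure_pmf.expectation (committed_string ?p (snd (u, i)) T) (reach_prob ?p (u, i)))"
      unfolding run(1) prob_bind_pmf
      by (intro expectation_cong_pmf prob_chosen_eq edge_prob_range)
         (use run(2) in \<open>auto simp: feasible_trace_def\<close>)
    also have "\<dots> = ?p (u, i) * measure_pmf.expectation (W i) (reach_prob ?p (u, i))"
      unfolding W_def by (subst expectation_bind_pmf[OF bnd]) simp
    also have "measure_pmf.expectation (W i) (reach_prob ?p (u, i)) =
        measure_pmf.expectation (W i)
          (\<lambda>es. reach_prob (pr H) (u, \<tau> i) (map (\<lambda>(u, _). (u, \<tau> i)) es))"
    proof (rule expectation_cong_pmf)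
      fix es assume "es \<in> set_pmf (W i)"
      from W[OF i this] obtain l where l: "l \<in> con H (\<tau> i)" "es = map (\<lambda>(u, b). (u, i)) l" by blast
      show "reach_prob ?p (u, i) es =
          reach_prob (pr H) (u, \<tau> i) (map (\<lambda>(u, _). (u, \<tau> i)) es)"
        unfolding l(2) typed[OF i l(1)] G_def
        by (rule reach_prob_instantiate[OF H \<tau>[OF i] con_string(2)[OF H \<tau>[OF i] l(1)]]) simp
    qed
    also have "\<dots> = measure_pmf.expectation (Y i) (reach_prob (pr H) (u, \<tau> i))"
      by (simp add: Y_def)
    also have "\<dots> = (\<Sum>es\<in>con H (\<tau> i). reach_prob (pr H) (u, \<tau> i) es * pmf (Y i) es)"
      by (rule integral_measure_pmf_real) (use finite_con[OF H \<tau>[OF i]] Y[OF i] in auto)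
    also have "?p (u, i) = pr H (u, \<tau> i)"
      using pr_range[OF H u \<tau>[OF i]] by (simp add: edge_prob_def G_def)
    finally show ?thesis by (simp add: sum_distrib_left mult.assoc)
  qed
  have feas: "feasible_trace ?G h" if "h \<in> set_pmf (offline_run ?G A)" for h
    using A that by (auto simp: offline_algorithms_def)
  have "(\<Sum>i=1..n. \<Sum>es\<in>con H (\<tau> i).
       pr H (u, \<tau> i) * reach_prob (pr H) (u, \<tau> i) es * pmf (Y i) es) \<le> 1" if u: "u \<in> off H" for u
  proof -
    have "(\<Sum>i=1..n. measure_pmf.prob (offline_run ?G A) {h. (u, i) \<in> chosen h}) \<le> 1"
      by (rule sum_prob_chosen_le_1) (use feas in \<open>auto simp: feasible_trace_def\<close>)
    then show ?thesis using prob[OF u] by simp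
  qed
  moreover have "measure_pmf.expectation (offline_run ?G A) (trace_weight ?G) =
      (\<Sum>i=1..n. \<Sum>es\<in>con H (\<tau> i). val H es * pmf (Y i) es)"
  proof -
    have "measure_pmf.expectation (offline_run ?G A) (trace_weight ?G) =
        (\<Sum>f\<in>edges ?G. wt ?G f * measure_pmf.prob (offline_run ?G A) {h. f \<in> chosen h})"
    proof (rule expectation_trace_weight[OF fin(1)])
      fix h assume "h \<in> set_pmf (offline_run ?G A)"
      then have "set (probed h) \<subseteq> edges ?G" using feas by (simp add: feasible_trace_def)
      then show "chosen h \<subseteq> edges ?G" using chosen_subset_probed[of h] by (rule order_trans[rotated])
    qed
    also have "\<dots> = (\<Sum>i=1..n. \<Sum>u\<in>off H. wt H (u, \<tau> i) *
        (\<Sum>es\<in>con H (\<tau> i). pr H (u, \<tau> i) * reach_prob (pr H) (u, \<tau> i) es * pmf (Y i) es))"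
      by (subst sum.swap) (simp add: edges_def G_def sum.cartesian_product' prob[unfolded G_def])
    also have "\<dots> = (\<Sum>i=1..n. \<Sum>es\<in>con H (\<tau> i). val H es * pmf (Y i) es)"
    proof (intro sum.cong refl)
      fix i assume i: "i \<in> {1..n}"
      have "(\<Sum>u\<in>off H. wt H (u, \<tau> i) *
          (\<Sum>es\<in>con H (\<tau> i). pr H (u, \<tau> i) * reach_prob (pr H) (u, \<tau> i) es * pmf (Y i) es)) =
        (\<Sum>es\<in>con H (\<tau> i). \<Sum>u\<in>off H. pr H (u, \<tau> i) * wt H (u, \<tau> i) *
            reach_prob (pr H) (u, \<tau> i) es * pmf (Y i) es)"
        by (subst sum.swap) (simp add: sum_distrib_left mult_ac)
      also have "\<dots> = (\<Sum>es\<in>con H (\<tau> i). val H es * pmf (Y i) es)"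
        by (intro sum.cong refl) (simp add: val_eq_sum_reach_prob[OF H \<tau>[OF i]] sum_distrib_right)
      finally show "(\<Sum>u\<in>off H. wt H (u, \<tau> i) *
          (\<Sum>es\<in>con H (\<tau> i). pr H (u, \<tau> i) * reach_prob (pr H) (u, \<tau> i) es * pmf (Y i) es)) =
        (\<Sum>es\<in>con H (\<tau> i). val H es * pmf (Y i) es)" .
    qed
    finally show ?thesis .
  qed
  ultimately show ?thesis using Y by blast
qed

section \<open>Averaging over the types\<close>

lemma set_types_pmf:
  assumes "known_id_input H n D" "\<tau> \<in> set_pmf (types_pmf n D)" "i \<in> {1..n}"
  shows "\<tau> i \<in> onl H"
proof -
  have "\<tau> i \<in> set_pmf (D i)" using assms(2,3) by (auto simp: types_pmf_def set_Pi_pmf PiE_dflt_def)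
  then show ?thesis using assms(1,3) by (auto simp only: known_id_input_def)
qed

lemma finite_set_types_pmf:
  assumes "known_id_input H n D"
  shows "finite (set_pmf (types_pmf n D))"
proof -
  have "finite (set_pmf (D i))" if "i \<in> {1..n}" for i
    using assms that finite_subset unfolding known_id_input_def stochastic_graph_def by blast
  then show ?thesis by (auto simp: types_pmf_def set_Pi_pmf intro!: finite_PiE_dflt)
qed

text \<open>The strings of \<open>b\<close> carry the total mass \<open>pmf (D i) b > 0\<close>, so
  some string is allowed, and with it the empty one. This will make \<open>OPT\<close> a supremum
  over a nonempty set.\<close>

lemma lp_feasible_imp_Nil_in_con:
  assumes H: "stochastic_graph H" and x: "lp_feasible H n D x"
    and r: "i \<in> {1..n}" "b \<in> onl H" "pmf (D i) b > 0"
  shows "[] \<in> con H b"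
proof -
  have "(\<Sum>es\<in>con H b. x i es b) = pmf (D i) b" using x r(1,2) by (simp add: lp_feasible_def)
  with r(3) have "con H b \<noteq> {}" by auto
  then obtain es where "es \<in> con H b" by blast
  from con_subseq[OF H r(2) this] show ?thesis by simp
qed

lemma offline_algorithms_nonempty:
  assumes "\<And>v. v \<in> onl G \<Longrightarrow> [] \<in> con G v"
  shows "offline_algorithms G \<noteq> {}"
proof -
  have "return_pmf Halt \<in> offline_algorithms G"
    using assms by (auto simp: offline_algorithms_def offline_run_def bind_return_pmf
        feasible_trace_def matching_def)
  then show ?thesis by blast
qed

text \<open>The supremum in \<open>OPT\<close> need not be attained, so for each type assignment an
  algorithm within \<epsilon> of it is converted into laws of strings.\<close>

theorem OPT_id_le_lp_value:
  fixes H :: "('u, 'b) sgraph" and n :: nat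
  assumes id: "known_id_input H n D"
    and r: "\<forall>i\<in>{1..n}. \<forall>b\<in>onl H. pmf (D i) b > 0"
    and x: "lp_optimal H n D x"
  shows "OPT_id H n D \<le> lp_value H n x"
proof (rule field_le_epsilon)
  fix \<epsilon> :: real assume "\<epsilon> > 0"
  let ?T = "set_pmf (types_pmf n D)" and ?P = "pmf (types_pmf n D)" and ?G = "instantiate H n"
  have H: "stochastic_graph H" using id by (simp add: known_id_input_def)
  have finB: "finite (onl H)" using H by (simp add: stochastic_graph_def)
  note finT = finite_set_types_pmf[OF id]
  note \<tau> = set_types_pmf[OF id]
  note finC = finite_con[OF H]
  have lpf: "lp_feasible H n D x" using x by (simp add: lp_optimal_def)
  define Q where "Q \<tau> Y \<longleftrightarrow> (\<forall>i\<in>{1..n}. set_pmf (Y i) \<subseteq> con H (\<tau> i)) \<and>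
    (\<forall>u\<in>off H. (\<Sum>i=1..n. \<Sum>es\<in>con H (\<tau> i).
       pr H (u, \<tau> i) * reach_prob (pr H) (u, \<tau> i) es * pmf (Y i) es) \<le> 1) \<and>
    OPT (?G \<tau>) \<le> (\<Sum>i=1..n. \<Sum>es\<in>con H (\<tau> i). val H es * pmf (Y i) es) + \<epsilon>" for \<tau> Y
  have "\<exists>Y. Q \<tau> Y"
    if "\<tau> \<in> ?T" for \<tau>
  proof -
    have ne: "offline_algorithms (?G \<tau>) \<noteq> {}"
    proof (rule offline_algorithms_nonempty)
      fix v assume v: "v \<in> onl (?G \<tau>)"
      then have "[] \<in> con H (\<tau> v)"
        using r \<tau>[OF that] by (intro lp_feasible_imp_Nil_in_con[OF H lpf]) auto
      then show "[] \<in> con (?G \<tau>) v" by force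
    qed
    have "OPT (?G \<tau>) - \<epsilon> < OPT (?G \<tau>)" using \<open>\<epsilon> > 0\<close> by simp
    then obtain A where A: "A \<in> offline_algorithms (?G \<tau>)"
      "OPT (?G \<tau>) - \<epsilon> < measure_pmf.expectation (offline_run (?G \<tau>) A) (trace_weight (?G \<tau>))"
      unfolding OPT_def using less_cSupD ne by (smt (verit) imageE image_is_empty)
    from offline_algorithm_configuration[OF H \<tau>[OF that] A(1)] A(2) show ?thesis
      unfolding Q_def by force
  qed
  then obtain Y where Q: "\<And>\<tau>. \<tau> \<in> ?T \<Longrightarrow> Q \<tau> (Y \<tau>)" by metis
  have Y: "\<And>\<tau> i. \<tau> \<in> ?T \<Longrightarrow> i \<in> {1..n} \<Longrightarrow> set_pmf (Y \<tau> i) \<subseteq> con H (\<tau> i)"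
    and load: "\<And>\<tau> u. \<tau> \<in> ?T \<Longrightarrow> u \<in> off H \<Longrightarrow> (\<Sum>i=1..n. \<Sum>es\<in>con H (\<tau> i).
       pr H (u, \<tau> i) * reach_prob (pr H) (u, \<tau> i) es * pmf (Y \<tau> i) es) \<le> 1"
    and opt: "\<And>\<tau>. \<tau> \<in> ?T \<Longrightarrow> OPT (?G \<tau>) \<le>
       (\<Sum>i=1..n. \<Sum>es\<in>con H (\<tau> i). val H es * pmf (Y \<tau> i) es) + \<epsilon>"
    using Q unfolding Q_def by blast+
  \<comment> \<open>The joint probability that vertex \<open>i\<close> has type \<open>b\<close> and
    its string is \<open>es\<close>.\<close>
  define X :: "('u, 'b) lp_var" where
    "X i es b = (\<Sum>\<tau>\<in>?T. if \<tau> i = b then ?P \<tau> * pmf (Y \<tau> i) es else 0)" for i es b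
  have sumP: "sum ?P ?T = 1" by (rule sum_pmf_eq_1[OF finT]) simp
  \<comment> \<open>Serves for the load as well as the value: in both, the coefficients depend only
    on type and string.\<close>
  have average: "(\<Sum>i=1..n. \<Sum>b\<in>onl H. \<Sum>es\<in>con H b. c b es * X i es b) =
      (\<Sum>\<tau>\<in>?T. ?P \<tau> * (\<Sum>i=1..n. \<Sum>es\<in>con H (\<tau> i). c (\<tau> i) es * pmf (Y \<tau> i) es))" for c
  proof -
    have "(\<Sum>i=1..n. \<Sum>b\<in>onl H. \<Sum>es\<in>con H b. c b es * X i es b) =
        (\<Sum>i=1..n. \<Sum>b\<in>onl H. \<Sum>\<tau>\<in>?T. if \<tau> i = b
           then (\<Sum>es\<in>con H b. ?P \<tau> * (c b es * pmf (Y \<tau> i) es)) else 0)"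
      unfolding X_def sum_distrib_left
      by (subst sum.swap[of _ ?T]) (intro sum.cong refl, auto intro!: sum.cong sum.neutral)
    also have "\<dots> = (\<Sum>i=1..n. \<Sum>\<tau>\<in>?T. \<Sum>b\<in>onl H. if \<tau> i = b
           then (\<Sum>es\<in>con H b. ?P \<tau> * (c b es * pmf (Y \<tau> i) es)) else 0)"
      by (subst sum.swap[of _ ?T]) rule
    also have "\<dots> = (\<Sum>i=1..n. \<Sum>\<tau>\<in>?T. \<Sum>es\<in>con H (\<tau> i). ?P \<tau> * (c (\<tau> i) es * pmf (Y \<tau> i) es))"
      using finB \<tau> by (intro sum.cong refl) (simp add: sum.delta)
    also have "\<dots> = (\<Sum>\<tau>\<in>?T. ?P \<tau> * (\<Sum>i=1..n. \<Sum>es\<in>con H (\<tau> i). c (\<tau> i) es * pmf (Y \<tau> i) es))"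
      by (subst sum.swap) (simp add: sum_distrib_left)
    finally show ?thesis .
  qed
  have "lp_feasible H n D X"
    unfolding lp_feasible_def
  proof (intro conjI ballI)
    fix i b es
    show "0 \<le> X i es b" unfolding X_def by (intro sum_nonneg) simp
  next
    fix u assume u: "u \<in> off H"
    have "(\<Sum>i=1..n. \<Sum>b\<in>onl H. \<Sum>es\<in>{es\<in>con H b. (u, b) \<in> set es}.
         pr H (u, b) * gprob H (before (u, b) es) * X i es b) =
       (\<Sum>i=1..n. \<Sum>b\<in>onl H. \<Sum>es\<in>con H b.
         pr H (u, b) * reach_prob (pr H) (u, b) es * X i es b)"
      by (intro sum.cong refl sum_containing_strings finC)
    also have "\<dots> = (\<Sum>\<tau>\<in>?T. ?P \<tau> * (\<Sum>i=1..n. \<Sum>es\<in>con H (\<tau> i).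
        pr H (u, \<tau> i) * reach_prob (pr H) (u, \<tau> i) es * pmf (Y \<tau> i) es))"
      by (rule average)
    also have "\<dots> \<le> (\<Sum>\<tau>\<in>?T. ?P \<tau> * 1)"
      by (intro sum_mono mult_left_mono load u) auto
    finally show "(\<Sum>i=1..n. \<Sum>b\<in>onl H. \<Sum>es\<in>{es\<in>con H b. (u, b) \<in> set es}.
         pr H (u, b) * gprob H (before (u, b) es) * X i es b) \<le> 1" using sumP by simp
  next
    fix i b assume i: "i \<in> {1..n}" and b: "b \<in> onl H"
    have "(\<Sum>es\<in>con H b. X i es b) =
        (\<Sum>\<tau>\<in>?T. if \<tau> i = b then ?P \<tau> * (\<Sum>es\<in>con H b. pmf (Y \<tau> i) es) else 0)"
      unfolding X_def by (subst sum.swap) (auto intro!: sum.cong simp: sum_distrib_left)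
    also have "\<dots> = (\<Sum>\<tau>\<in>?T. if \<tau> i = b then ?P \<tau> else 0)"
      by (intro sum.cong refl) (use Y i finC[OF b] in \<open>auto simp: sum_pmf_eq_1\<close>)
    also have "\<dots> = measure_pmf.prob (types_pmf n D) {\<tau>. \<tau> i = b}"
    proof -
      have "measure_pmf.prob (types_pmf n D) {\<tau>. \<tau> i = b} =
          measure_pmf.expectation (types_pmf n D) (indicator {\<tau>. \<tau> i = b})" by simp
      also have "\<dots> = (\<Sum>\<tau>\<in>?T. indicator {\<tau>. \<tau> i = b} \<tau> * ?P \<tau>)"
        by (rule integral_measure_pmf_real[OF finT]) auto
      finally show ?thesis by (auto intro!: sum.cong)
    qed
    also have "\<dots> = pmf (map_pmf (\<lambda>\<tau>. \<tau> i) (types_pmf n D)) b"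
      by (simp add: pmf_map vimage_def)
    also have "\<dots> = pmf (D i) b"
      using i by (simp add: types_pmf_def Pi_pmf_component)
    finally show "(\<Sum>es\<in>con H b. X i es b) = pmf (D i) b" .
  qed
  then have "lp_value H n X \<le> lp_value H n x" using x by (simp add: lp_optimal_def)
  moreover have "OPT_id H n D \<le> lp_value H n X + \<epsilon>"
  proof -
    have "OPT_id H n D = (\<Sum>\<tau>\<in>?T. OPT (?G \<tau>) * ?P \<tau>)"
      unfolding OPT_id_def by (rule integral_measure_pmf_real[OF finT]) auto
    also have "\<dots> \<le> (\<Sum>\<tau>\<in>?T. ((\<Sum>i=1..n. \<Sum>es\<in>con H (\<tau> i). val H es * pmf (Y \<tau> i) es) + \<epsilon>) * ?P \<tau>)"
      by (intro sum_mono mult_right_mono opt) auto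
    also have "\<dots> = lp_value H n X + sum ?P ?T * \<epsilon>"
      unfolding lp_value_def average
      by (simp add: distrib_left sum.distrib sum_distrib_left mult.commute)
    also have "\<dots> = lp_value H n X + \<epsilon>" by (simp add: sumP)
    finally show ?thesis .
  qed
  ultimately show "OPT_id H n D \<le> lp_value H n x + \<epsilon>" by simp
qed

section \<open>Online runs\<close>

lemma run_probe_until_active:
  assumes "h \<in> set_pmf (run_tree st (probe_until_active acc es))"
  shows "prefix (probed h) es \<and>
         (chosen h = {} \<or> (\<exists>e\<in>set es. chosen h = {e} \<and> True \<in> set_pmf (acc e)))"
  using assms
proof (induction es arbitrary: h)
  case Nil
  then show ?case by simp
next
  case (Cons e es)
  show ?case
  proof (cases "st e")
    case True
    then obtain a where "a \<in> set_pmf (acc e)" "h = [(e, True, a)]"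
      using Cons.prems by (auto simp: run_tree_Probe bind_map_pmf)
    then show ?thesis by auto
  next
    case False
    then obtain h' where h': "h' \<in> set_pmf (run_tree st (probe_until_active acc es))"
      "h = (e, False, False) # h'"
      using Cons.prems by (auto simp: run_tree_Probe bind_return_pmf)
    from Cons.IH[OF h'(1)] show ?thesis unfolding h'(2) by auto
  qed
qed

text \<open>Transfers statements on traces for given states to fresh runs; deferred sampling applies
  since the probed edges form a prefix of a distinct list.\<close>

lemma set_fresh_run_probe_until_active:
  assumes "distinct es" "h \<in> set_pmf (fresh_run p (probe_until_active acc es))"
  shows "\<exists>st. h \<in> set_pmf (run_tree st (probe_until_active acc es))"
proof -
  have "bind_pmf (Pi_pmf (set es) False (\<lambda>e. bernoulli_pmf (p e)))
          (\<lambda>st. run_tree st (probe_until_active acc es)) =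
        fresh_run p (probe_until_active acc es)"
  proof (rule presampled_states_eq_fresh_run)
    fix st h assume "h \<in> set_pmf (run_tree st (probe_until_active acc es))"
    then have "prefix (probed h) es" using run_probe_until_active by blast
    with assms(1) show "distinct (probed h) \<and> set (probed h) \<subseteq> set es"
      by (auto simp: prefix_def)
  qed simp
  with assms(2) show ?thesis by (metis UN_E set_bind_pmf)
qed

text \<open>The edge \<open>f\<close> is added if it is reached, is active, and its coin succeeds;
  these three events are independent.\<close>

lemma prob_chosen_probe_until_active:
  assumes p: "\<And>e. 0 \<le> p e \<and> p e \<le> 1" and "distinct es"
  shows "measure_pmf.prob (fresh_run p (probe_until_active acc es)) {h. f \<in> chosen h} =
         p f * reach_prob p f es * pmf (acc f) True"
  using assms(2)
proof (induction es)
  case Nil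
  show ?case by simp
next
  case (Cons e es)
  let ?M = "measure_pmf.prob (fresh_run p (probe_until_active acc es)) {h. f \<in> chosen h}"
  have M: "?M = p f * reach_prob p f es * pmf (acc f) True" using Cons by simp
  have "measure_pmf.prob (fresh_run p (probe_until_active acc (e # es))) {h. f \<in> chosen h} =
    measure_pmf.expectation (acc e) (\<lambda>a. p e * indicator {a. a \<and> f = e} a + (1 - p e) * ?M)"
    by (auto simp: fresh_run_Probe prob_bind_pmf bind_map_pmf bind_return_pmf p vimage_def
          mult.commute indicator_def intro!: expectation_cong_pmf)
  also have "\<dots> = p e * measure_pmf.prob (acc e) {a. a \<and> f = e} + (1 - p e) * ?M"
    by (subst Bochner_Integration.integral_add)
       (auto intro!: integrable_pmf_bounded[where B = 1] split: split_indicator)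
  also have "\<dots> = p f * reach_prob p f (e # es) * pmf (acc f) True"
  proof (cases "f = e")
    case True
    then have "reach_prob p f es = 0" using Cons.prems by (simp add: reach_prob_def)
    moreover have "{a. a \<and> f = e} = {True}" using True by auto
    ultimately show ?thesis using True M by (simp add: measure_pmf_single)
  next
    case False
    then show ?thesis unfolding M by simp
  qed
  finally show ?case .
qed

section \<open>Sampling the states arrival by arrival\<close>

lemma process_arrivals_cong:
  assumes "\<And>past i T st h. i \<in> set is \<Longrightarrow> T \<in> set_pmf (A past i (\<tau> i) (Y i)) \<Longrightarrow>
      h \<in> set_pmf (run_tree st T) \<Longrightarrow> set (probed h) \<subseteq> U \<times> {i}"
    and "\<And>e. e \<in> U \<times> set is \<Longrightarrow> st e = st' e"
  shows "process_arrivals A \<tau> Y st is past = process_arrivals A \<tau> Y st' is past"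
  using assms
proof (induction "is" arbitrary: past)
  case (Cons i "is")
  have "run_tree st T = run_tree st' T" if "T \<in> set_pmf (A past i (\<tau> i) (Y i))" for T
  proof (rule run_tree_cong)
    fix h e assume "h \<in> set_pmf (run_tree st T)" "e \<in> set (probed h)"
    with Cons.prems(1)[OF _ that, of h st] have "e \<in> U \<times> {i}" by auto
    then show "st e = st' e" using Cons.prems(2)[of e] by auto
  qed
  moreover have "process_arrivals A \<tau> Y st is past' = process_arrivals A \<tau> Y st' is past'" for past'
    by (rule Cons.IH) (use Cons.prems in auto)
  ultimately show ?case by (auto intro!: bind_pmf_cong)
qed simp

primrec fresh_process ::
    "('u \<times> nat \<Rightarrow> real) \<Rightarrow> ('u, 'b) online_alg \<Rightarrow> (nat \<Rightarrow> 'b) \<Rightarrow> (nat \<Rightarrow> real) \<Rightarrow>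
     nat list \<Rightarrow> ('u, 'b) past \<Rightarrow> ('u, 'b) past pmf" where
  "fresh_process p A \<tau> Y [] past = return_pmf past"
| "fresh_process p A \<tau> Y (i # is) past =
     bind_pmf (bind_pmf (A past i (\<tau> i) (Y i)) (fresh_run p)) (\<lambda>h.
     fresh_process p A \<tau> Y is (past @ [(i, \<tau> i, Y i, h)]))"

text \<open>Each arrival probes only edges at its own vertex, so the product law of the states
  splits into the block of the current vertex and that of the later ones.\<close>

lemma presampled_states_eq_fresh_process:
  assumes "finite U" "distinct is"
    and "\<And>past i T st h. i \<in> set is \<Longrightarrow> T \<in> set_pmf (A past i (\<tau> i) (Y i)) \<Longrightarrow>
      h \<in> set_pmf (run_tree st T) \<Longrightarrow> distinct (probed h) \<and> set (probed h) \<subseteq> U \<times> {i}"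
  shows "bind_pmf (Pi_pmf (U \<times> set is) False (\<lambda>e. bernoulli_pmf (p e)))
           (\<lambda>st. process_arrivals A \<tau> Y st is past) = fresh_process p A \<tau> Y is past"
  using assms(2,3)
proof (induction "is" arbitrary: past)
  case Nil
  show ?case by simp
next
  case (Cons i "is")
  let ?P = "\<lambda>E. Pi_pmf E False (\<lambda>e. bernoulli_pmf (p e))"
  let ?proc = "process_arrivals A \<tau> Y"
  have split: "U \<times> set (i # is) = U \<times> {i} \<union> U \<times> set is" by auto
  \<comment> \<open>The current arrival reads only the block \<open>f\<close>, all later arrivals
    only \<open>g\<close>.\<close>
  have comb: "?proc (\<lambda>e. if e \<in> U \<times> {i} then f e else g e) (i # is) past =
      bind_pmf (A past i (\<tau> i) (Y i)) (\<lambda>T. bind_pmf (run_tree f T) (\<lambda>h.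
        ?proc g is (past @ [(i, \<tau> i, Y i, h)])))" for f g
  proof -
    define st where "st = (\<lambda>e. if e \<in> U \<times> {i} then f e else g e)"
    have "run_tree st T = run_tree f T" if "T \<in> set_pmf (A past i (\<tau> i) (Y i))" for T
    proof (rule run_tree_cong)
      fix h e assume "h \<in> set_pmf (run_tree st T)" "e \<in> set (probed h)"
      with Cons.prems(2)[OF _ that, of h st] show "st e = f e" by (auto simp: st_def)
    qed
    moreover have "?proc st is past' = ?proc g is past'" for past'
      by (rule process_arrivals_cong[where U = U]) (use Cons.prems in \<open>auto simp: st_def\<close>)
    ultimately show ?thesis unfolding st_def[symmetric] by (auto intro!: bind_pmf_cong)
  qed
  have IH: "bind_pmf (?P (U \<times> set is)) (\<lambda>st. ?proc st is past') = fresh_process p A \<tau> Y is past'"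
    for past'
  proof (rule Cons.IH)
    show "distinct is" using Cons.prems(1) by simp
    show "distinct (probed h) \<and> set (probed h) \<subseteq> U \<times> {j}"
      if "j \<in> set is" "T \<in> set_pmf (A past j (\<tau> j) (Y j))" "h \<in> set_pmf (run_tree st T)"
      for past j T st h
      using Cons.prems(2)[OF _ that(2,3)] that(1) by simp
  qed
  have "bind_pmf (?P (U \<times> set (i # is))) (\<lambda>st. ?proc st (i # is) past) =
      bind_pmf (?P (U \<times> {i})) (\<lambda>f. bind_pmf (?P (U \<times> set is)) (\<lambda>g.
        ?proc (\<lambda>e. if e \<in> U \<times> {i} then f e else g e) (i # is) past))"
    unfolding split using Cons.prems(1) assms(1)
    by (subst Pi_pmf_union) (auto simp: bind_map_pmf pair_pmf_def bind_assoc_pmf bind_return_pmf)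
  also have "\<dots> = bind_pmf (A past i (\<tau> i) (Y i)) (\<lambda>T.
      bind_pmf (?P (U \<times> {i})) (\<lambda>f. bind_pmf (run_tree f T) (\<lambda>h.
      bind_pmf (?P (U \<times> set is)) (\<lambda>g. ?proc g is (past @ [(i, \<tau> i, Y i, h)])))))"
    unfolding comb
    by (subst bind_commute_pmf[of "?P (U \<times> set is)"], subst bind_commute_pmf[of "?P (U \<times> {i})"],
        subst bind_commute_pmf[of "?P (U \<times> set is)"]) rule
  also have "\<dots> = bind_pmf (A past i (\<tau> i) (Y i)) (\<lambda>T.
      bind_pmf (bind_pmf (?P (U \<times> {i})) (\<lambda>f. run_tree f T)) (\<lambda>h.
        fresh_process p A \<tau> Y is (past @ [(i, \<tau> i, Y i, h)])))"
    unfolding IH by (simp add: bind_assoc_pmf)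
  also have "\<dots> = bind_pmf (A past i (\<tau> i) (Y i)) (\<lambda>T.
      bind_pmf (fresh_run p T) (\<lambda>h. fresh_process p A \<tau> Y is (past @ [(i, \<tau> i, Y i, h)])))"
    by (intro bind_pmf_cong refl arg_cong2[where f = bind_pmf] presampled_states_eq_fresh_run)
       (use Cons.prems(2)[of i] assms(1) in auto)
  finally show ?case by (simp add: bind_assoc_pmf)
qed

section \<open>ROM-ID run with a feasible LP solution\<close>

locale rom_id_input =
  fixes H :: "('u, 'b) sgraph" and n :: nat and D :: "nat \<Rightarrow> 'b pmf" and x :: "('u, 'b) lp_var"
  assumes id: "known_id_input H n D"
    and r: "\<And>i b. i \<in> {1..n} \<Longrightarrow> b \<in> onl H \<Longrightarrow> pmf (D i) b > 0"
    and feasible: "lp_feasible H n D x"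
begin

lemma H: "stochastic_graph H" using id by (simp add: known_id_input_def)

lemma x_nonneg: "i \<in> {1..n} \<Longrightarrow> b \<in> onl H \<Longrightarrow> es \<in> con H b \<Longrightarrow> 0 \<le> x i es b"
  using feasible unfolding lp_feasible_def by blast

text \<open>The equality constraint of the LP, divided by the positive probability of the type,
  makes the total mass 1.\<close>

lemma pmf_string_pmf:
  assumes i: "i \<in> {1..n}" and b: "b \<in> onl H"
  shows "pmf (string_pmf H D x i b) es = (if es \<in> con H b then x i es b / pmf (D i) b else 0)"
  unfolding string_pmf_def
proof (rule pmf_embed_pmf)
  show "0 \<le> (if es \<in> con H b then x i es b / pmf (D i) b else 0)" for es
    using x_nonneg[OF i b] by simp
  have "(\<integral>\<^sup>+ es. ennreal (if es \<in> con H b then x i es b / pmf (D i) b else 0) \<partial>count_space UNIV) =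
      (\<Sum>es\<in>con H b. ennreal (x i es b / pmf (D i) b))"
    by (subst nn_integral_count_space'[OF finite_con[OF H b]]) auto
  also have "\<dots> = ennreal (\<Sum>es\<in>con H b. x i es b / pmf (D i) b)"
    using x_nonneg[OF i b] by (subst sum_ennreal) auto
  also have "(\<Sum>es\<in>con H b. x i es b / pmf (D i) b) = 1"
    using feasible i b r[OF i b] by (simp add: lp_feasible_def flip: sum_divide_distrib)
  finally show "(\<integral>\<^sup>+ es. ennreal (if es \<in> con H b then x i es b / pmf (D i) b else 0)
      \<partial>count_space UNIV) = 1" by simp
qed

lemma set_string_pmf:
  assumes "i \<in> {1..n}" "b \<in> onl H"
  shows "set_pmf (string_pmf H D x i b) \<subseteq> con H b"
  using assms by (auto simp: set_pmf_eq pmf_string_pmf)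

abbreviation "rom \<equiv> rom_id H D x"

abbreviation "onto i es \<equiv> map (\<lambda>(u, b). (u, i)) es"

lemma distinct_onto:
  assumes "b \<in> onl H" "es \<in> con H b"
  shows "distinct (onto i es)" "set (onto i es) \<subseteq> off H \<times> {i}"
  using con_string[OF H assms] by (auto simp: distinct_map inj_on_def)

lemma rom_tree:
  assumes i: "i \<in> {1..n}" and b: "b \<in> onl H" and T: "T \<in> set_pmf (rom past i b y)"
  obtains es where "es \<in> con H b"
    "T = probe_until_active (rom_accept H x past y) (onto i es)"
  using T set_string_pmf[OF i b] by (auto simp: rom_id_def)

text \<open>Stopping at an active edge leaves a prefix of an allowed string, which is again allowed;
  the acceptance coin is 0 at a matched offline vertex.\<close>

lemma rom_trace:
  assumes i: "i \<in> {1..n}" and b: "b \<in> onl H" and T: "T \<in> set_pmf (rom past i b y)"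
    and h: "h \<in> set_pmf (run_tree st T)"
  shows "probed h \<in> onto i ` con H b" "distinct (probed h)" "set (probed h) \<subseteq> off H \<times> {i}"
    "chosen h = {} \<or> (\<exists>u\<in>off H. chosen h = {(u, i)} \<and> u \<notin> fst ` chosen (past_trace past))"
proof -
  obtain es where es: "es \<in> con H b" "T = probe_until_active (rom_accept H x past y) (onto i es)"
    using rom_tree[OF i b T] .
  note run = run_probe_until_active[OF h[unfolded es(2)]]
  note onto = distinct_onto[OF b es(1), of i]
  have pre: "prefix (probed h) (onto i es)" using run by simp
  then have "probed h = take (length (probed h)) (onto i es)"
    by (metis append_eq_conv_conj prefix_def)
  then have take: "probed h = onto i (take (length (probed h)) es)" by (simp add: take_map)
  moreover have "take (length (probed h)) es \<in> con H b"
    by (rule con_subseq[OF H b es(1)]) (simp add: prefix_imp_subseq take_is_prefix)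
  ultimately show "probed h \<in> onto i ` con H b" by (rule image_eqI)
  show "distinct (probed h)" using pre onto(1) by (metis distinct_append prefixE)
  show "set (probed h) \<subseteq> off H \<times> {i}" using set_mono_prefix[OF pre] onto(2) by (rule order_trans)
  show "chosen h = {} \<or> (\<exists>u\<in>off H. chosen h = {(u, i)} \<and> u \<notin> fst ` chosen (past_trace past))"
  proof (cases "chosen h = {}")
    case False
    with run obtain e where e: "e \<in> set (onto i es)" "chosen h = {e}"
      "True \<in> set_pmf (rom_accept H x past y e)" by blast
    obtain u where u: "e = (u, i)" "u \<in> off H" using e(1) onto(2) by blast
    have "u \<notin> fst ` chosen (past_trace past)" using e(3) unfolding u(1) rom_accept_def by (cases "u \<in> fst ` chosen (past_trace past)") simp_all
    with e(2) u show ?thesis by blast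
  qed simp
qed

text \<open>The probability that VertexProbe outputs the edge to \<open>u\<close>, given that vertex
  \<open>i\<close> has type \<open>b\<close>.\<close>

definition output_prob :: "'u \<Rightarrow> nat \<Rightarrow> 'b \<Rightarrow> real" where
  "output_prob u i b = pr H (u, b) * xtilde H x u i b / pmf (D i) b"

text \<open>The minimum with 1 (again the clamping of \<open>bernoulli_pmf\<close>) only matters for negative times. It
  makes the formula exact for every \<open>y\<close>, which yields measurability in the arrival times.\<close>

definition accept_prob :: "'u \<Rightarrow> nat \<Rightarrow> real \<Rightarrow> real" where
  "accept_prob u i y = min 1 (exp (- y * zval H x u i))"

lemma pmf_rom_accept:
  "pmf (rom_accept H x past y (u, i)) True =
     (if u \<in> fst ` chosen (past_trace past) then 0 else accept_prob u i y)"
proof -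
  have "pmf (bernoulli_pmf c) True = min 1 c" if "0 \<le> c" for c
    by (subst bernoulli_pmf_clamp[symmetric], subst pmf_bernoulli_True) (use that in auto)
  then show ?thesis by (simp add: rom_accept_def accept_prob_def)
qed

lemma prob_rom_chosen:
  assumes i: "i \<in> {1..n}" and \<tau>: "\<tau> i \<in> onl H" and u: "u \<in> off H"
  shows "measure_pmf.prob (bind_pmf (rom past i (\<tau> i) y)
             (fresh_run (edge_prob (instantiate H n \<tau>)))) {h. (u, i) \<in> chosen h} =
         (if u \<in> fst ` chosen (past_trace past) then 0
          else output_prob u i (\<tau> i) * accept_prob u i y)"
proof -
  let ?p = "edge_prob (instantiate H n \<tau>)" and ?S = "string_pmf H D x i (\<tau> i)"
  let ?a = "pmf (rom_accept H x past y (u, i)) True"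
  have p: "?p (u, i) = pr H (u, \<tau> i)"
    using pr_range[OF H u \<tau>] by (simp add: edge_prob_def)
  have "measure_pmf.prob (bind_pmf (rom past i (\<tau> i) y) (fresh_run ?p)) {h. (u, i) \<in> chosen h} =
      measure_pmf.expectation ?S (\<lambda>es. pr H (u, \<tau> i) * reach_prob (pr H) (u, \<tau> i) es * ?a)"
    unfolding rom_id_def bind_map_pmf prob_bind_pmf
  proof (rule expectation_cong_pmf)
    fix es assume "es \<in> set_pmf ?S"
    then have es: "es \<in> con H (\<tau> i)" using set_string_pmf[OF i \<tau>] by blast
    show "measure_pmf.prob (fresh_run ?p (probe_until_active (rom_accept H x past y) (onto i es)))
        {h. (u, i) \<in> chosen h} = pr H (u, \<tau> i) * reach_prob (pr H) (u, \<tau> i) es * ?a"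
      using prob_chosen_probe_until_active[of ?p "onto i es" _ "(u, i)", OF edge_prob_range
          distinct_onto(1)[OF \<tau> es]] reach_prob_instantiate[OF H \<tau> con_string(2)[OF H \<tau> es], of \<tau> i n u] p
      by simp
  qed
  also have "\<dots> = (\<Sum>es\<in>con H (\<tau> i).
      pr H (u, \<tau> i) * reach_prob (pr H) (u, \<tau> i) es * ?a * pmf ?S es)"
    by (rule integral_measure_pmf_real) (use finite_con[OF H \<tau>] set_string_pmf[OF i \<tau>] in auto)
  also have "\<dots> = output_prob u i (\<tau> i) * ?a"
  proof -
    have "(\<Sum>es\<in>con H (\<tau> i). pr H (u, \<tau> i) * reach_prob (pr H) (u, \<tau> i) es * ?a * pmf ?S es) =
        (\<Sum>es\<in>con H (\<tau> i). 1 * reach_prob (pr H) (u, \<tau> i) es * x i es (\<tau> i)) *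
          (pr H (u, \<tau> i) * ?a / pmf (D i) (\<tau> i))"
      unfolding sum_distrib_right by (intro sum.cong refl) (simp add: pmf_string_pmf[OF i \<tau>])
    also have "\<dots> = output_prob u i (\<tau> i) * ?a"
      unfolding sum_containing_strings[OF finite_con[OF H \<tau>], symmetric]
      by (simp add: output_prob_def xtilde_def)
    finally show ?thesis .
  qed
  finally show ?thesis by (simp add: pmf_rom_accept)
qed

text \<open>Read off from a first arrival at time 0, when \<open>u\<close> is free and the
  acceptance probability is \<open>exp 0 = 1\<close>.\<close>

lemma output_prob_range:
  assumes "i \<in> {1..n}" "b \<in> onl H" "u \<in> off H"
  shows "0 \<le> output_prob u i b \<and> output_prob u i b \<le> 1"
proof -
  have "output_prob u i b = measure_pmf.prob (bind_pmf (rom [] i b 0)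
      (fresh_run (edge_prob (instantiate H n (\<lambda>_. b))))) {h. (u, i) \<in> chosen h}"
    using prob_rom_chosen[of i "\<lambda>_. b" u "[]" 0] assms by (simp add: past_trace_def accept_prob_def)
  then show ?thesis by simp
qed

lemma set_fresh_rom:
  assumes i: "i \<in> {1..n}" and b: "b \<in> onl H"
    and h: "h \<in> set_pmf (bind_pmf (rom past i b y) (fresh_run p))"
  shows "chosen h \<subseteq> UNIV \<times> {i}" "fst ` chosen h \<inter> fst ` chosen (past_trace past) = {}"
proof -
  obtain T where T: "T \<in> set_pmf (rom past i b y)" "h \<in> set_pmf (fresh_run p T)" using h by auto
  obtain es where es: "es \<in> con H b" "T = probe_until_active (rom_accept H x past y) (onto i es)"
    using rom_tree[OF i b T(1)] .
  obtain st where "h \<in> set_pmf (run_tree st T)"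
    using set_fresh_run_probe_until_active[OF distinct_onto(1)[OF b es(1)] T(2)[unfolded es(2)]]
    unfolding es(2) by blast
  from rom_trace(4)[OF i b T(1) this]
  show "chosen h \<subseteq> UNIV \<times> {i}" "fst ` chosen h \<inter> fst ` chosen (past_trace past) = {}" by force+
qed

lemma past_trace_snoc: "past_trace (past @ [(i, b, y, h)]) = past_trace past @ h"
  by (simp add: past_trace_def)

lemma fresh_process_chosen_elsewhere:
  assumes "set is \<subseteq> {1..n}" "\<And>i. i \<in> set is \<Longrightarrow> \<tau> i \<in> onl H" "t \<notin> set is"
    and "past' \<in> set_pmf (fresh_process p rom \<tau> Y is past)"
  shows "(u, t) \<in> chosen (past_trace past') \<longleftrightarrow> (u, t) \<in> chosen (past_trace past)"
  using assms
proof (induction "is" arbitrary: past)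
  case (Cons i "is")
  then obtain h where h: "h \<in> set_pmf (bind_pmf (rom past i (\<tau> i) (Y i)) (fresh_run p))"
    "past' \<in> set_pmf (fresh_process p rom \<tau> Y is (past @ [(i, \<tau> i, Y i, h)]))" by auto
  have "(u, t) \<notin> chosen h" using set_fresh_rom(1)[OF _ _ h(1)] Cons.prems by auto
  moreover have "(u, t) \<in> chosen (past_trace past') \<longleftrightarrow>
      (u, t) \<in> chosen (past_trace (past @ [(i, \<tau> i, Y i, h)]))"
    by (rule Cons.IH) (use Cons.prems h in auto)
  ultimately show ?case by (simp add: past_trace_snoc)
qed simp

text \<open>The past matters for \<open>u\<close> only through whether \<open>u\<close> is matched,
  and a matched \<open>u\<close> stays matched. Conditionally on \<open>u\<close> being free, each
  vertex before \<open>t\<close> keeps it free with a probability that depends only on its own type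
  and time, so these probabilities multiply.\<close>

lemma prob_fresh_process_chosen:
  assumes "distinct is" "set is \<subseteq> {1..n}" "\<And>i. i \<in> set is \<Longrightarrow> \<tau> i \<in> onl H"
    and "t \<in> set is" "u \<in> off H" "(u, t) \<notin> chosen (past_trace past)"
  shows "measure_pmf.prob (fresh_process (edge_prob (instantiate H n \<tau>)) rom \<tau> Y is past)
           {past'. (u, t) \<in> chosen (past_trace past')} =
         (if u \<in> fst ` chosen (past_trace past) then 0
          else output_prob u t (\<tau> t) * accept_prob u t (Y t) *
               (\<Prod>i\<leftarrow>takeWhile (\<lambda>i. i \<noteq> t) is. 1 - output_prob u i (\<tau> i) * accept_prob u i (Y i)))"
  using assms
proof (induction "is" arbitrary: past)
  case Nil
  then show ?case by simp
next
  case (Cons i "is")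
  let ?p = "edge_prob (instantiate H n \<tau>)"
  let ?R = "bind_pmf (rom past i (\<tau> i) (Y i)) (fresh_run ?p)"
  let ?X = "{past'. (u, t) \<in> chosen (past_trace past')}"
  let ?m = "\<lambda>past. u \<in> fst ` chosen (past_trace past)"
  have i: "i \<in> {1..n}" "\<tau> i \<in> onl H" using Cons.prems by auto
  note R = prob_rom_chosen[of i \<tau> u past "Y i", OF i Cons.prems(5)]
  have step: "measure_pmf.prob (fresh_process ?p rom \<tau> Y (i # is) past) ?X =
      measure_pmf.expectation ?R (\<lambda>h. measure_pmf.prob
        (fresh_process ?p rom \<tau> Y is (past @ [(i, \<tau> i, Y i, h)])) ?X)"
    unfolding fresh_process.simps by (rule prob_bind_pmf)
  show ?case
  proof (cases "i = t")
    case True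
    \<comment> \<open>Later arrivals add only edges at their own vertices, so the arrival of
      \<open>t\<close> settles the event.\<close>
    have "measure_pmf.prob (fresh_process ?p rom \<tau> Y is (past @ [(i, \<tau> i, Y i, h)])) ?X =
        indicator {h. (u, t) \<in> chosen h} h" for h
    proof -
      have iff: "past' \<in> ?X \<longleftrightarrow> (u, t) \<in> chosen h"
        if "past' \<in> set_pmf (fresh_process ?p rom \<tau> Y is (past @ [(i, \<tau> i, Y i, h)]))" for past'
        using fresh_process_chosen_elsewhere[OF _ _ _ that, of t u] Cons.prems True
        by (auto simp: past_trace_snoc)
      show ?thesis
      proof (cases "(u, t) \<in> chosen h")
        case True
        then have "measure_pmf.prob (fresh_process ?p rom \<tau> Y is (past @ [(i, \<tau> i, Y i, h)])) ?X = 1"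
          using iff by (subst measure_pmf.prob_eq_1) (auto simp: AE_measure_pmf_iff)
        with True show ?thesis by simp
      next
        case False
        then have "measure_pmf.prob (fresh_process ?p rom \<tau> Y is (past @ [(i, \<tau> i, Y i, h)])) ?X = 0"
          using iff by (subst measure_pmf_zero_iff) blast
        with False show ?thesis by simp
      qed
    qed
    then show ?thesis unfolding step using R True by simp
  next
    case False
    define c where "c = output_prob u t (\<tau> t) * accept_prob u t (Y t) *
      (\<Prod>i\<leftarrow>takeWhile (\<lambda>i. i \<noteq> t) is. 1 - output_prob u i (\<tau> i) * accept_prob u i (Y i))"
    have "measure_pmf.prob (fresh_process ?p rom \<tau> Y (i # is) past) ?X =
        measure_pmf.expectation ?R (\<lambda>h. if ?m past then 0 else c * indicator (- {h. (u, i) \<in> chosen h}) h)"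
      unfolding step
    proof (rule expectation_cong_pmf)
      fix h assume h: "h \<in> set_pmf ?R"
      note ch = set_fresh_rom(1)[OF i h]
      have "measure_pmf.prob (fresh_process ?p rom \<tau> Y is (past @ [(i, \<tau> i, Y i, h)])) ?X =
          (if ?m (past @ [(i, \<tau> i, Y i, h)]) then 0 else c)"
        unfolding c_def
        by (rule Cons.IH) (use Cons.prems False ch in \<open>auto simp: past_trace_snoc\<close>)
      moreover have "?m (past @ [(i, \<tau> i, Y i, h)]) \<longleftrightarrow> ?m past \<or> (u, i) \<in> chosen h"
        using ch by (force simp: past_trace_snoc)
      ultimately show "measure_pmf.prob (fresh_process ?p rom \<tau> Y is (past @ [(i, \<tau> i, Y i, h)])) ?X =
          (if ?m past then 0 else c * indicator (- {h. (u, i) \<in> chosen h}) h)"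
        by simp
    qed
    also have "\<dots> = (if ?m past then 0 else c * (1 - measure_pmf.prob ?R {h. (u, i) \<in> chosen h}))"
      using measure_pmf.prob_compl[of "{h. (u, i) \<in> chosen h}" ?R] by (simp add: Compl_eq_Diff_UNIV)
    also have "\<dots> = (if ?m past then 0 else c * (1 - output_prob u i (\<tau> i) * accept_prob u i (Y i)))"
      using R by simp
    finally show ?thesis using False by (simp add: c_def mult_ac)
  qed
qed

end

section \<open>The order of processing\<close>

definition arrives_before :: "(nat \<Rightarrow> real) \<Rightarrow> nat \<Rightarrow> nat \<Rightarrow> bool" where
  "arrives_before Y i t \<longleftrightarrow> Y i < Y t \<or> Y i = Y t \<and> i < t"

text \<open>\<open>insort_key\<close> puts a new element in front of those with an equal key, and
  sorting inserts from the right end. On an increasing list this resolves ties by index.\<close>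

lemma sorted_wrt_arrives_before_insort_key:
  assumes "sorted_wrt (arrives_before Y) ys" "\<And>y. y \<in> set ys \<Longrightarrow> i < y"
  shows "sorted_wrt (arrives_before Y) (insort_key Y i ys)"
  using assms by (induction ys) (auto simp: arrives_before_def set_insort_key)

lemma sorted_wrt_arrives_before_sort_key:
  assumes "sorted_wrt (<) is"
  shows "sorted_wrt (arrives_before Y) (sort_key Y is)"
  using assms by (induction "is") (auto intro!: sorted_wrt_arrives_before_insort_key)

lemma set_takeWhile_arrives_before:
  assumes "sorted_wrt (arrives_before Y) is" "t \<in> set is"
  shows "set (takeWhile (\<lambda>i. i \<noteq> t) is) = {i \<in> set is. arrives_before Y i t}"
  using assms
proof (induction "is")
  case (Cons i "is")
  show ?case
  proof (cases "i = t")
    case True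
    then have "\<not> arrives_before Y j t" if "j \<in> set (i # is)" for j
      using Cons.prems(1) that by (auto simp: arrives_before_def)
    with True show ?thesis by auto
  next
    case False
    then have "t \<in> set is" "arrives_before Y i t" using Cons.prems by auto
    with False Cons show ?thesis by auto
  qed
qed simp

section \<open>The outcome for fixed arrival times\<close>

context rom_id_input
begin

lemma Nil_in_con: "b \<in> onl H \<Longrightarrow> [] \<in> con H b"
  using lp_feasible_imp_Nil_in_con[OF H feasible, of 1 b] r[of 1 b] id
  by (simp add: known_id_input_def)

text \<open>Invariant: the vertices still to come have not been probed. So the probes at
  \<open>i\<close> are exactly those of its own arrival, and a new edge meets neither a matched
  offline vertex nor an earlier online vertex.\<close>

lemma process_rom_feasible:
  fixes \<tau> :: "nat \<Rightarrow> 'b"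
  defines "G \<equiv> instantiate H n \<tau>"
  assumes "past' \<in> set_pmf (process_arrivals rom \<tau> Y st is past)"
    and "distinct is" "set is \<subseteq> {1..n}" "\<And>i. i \<in> {1..n} \<Longrightarrow> \<tau> i \<in> onl H"
    and "feasible_trace G (past_trace past)" "snd ` set (probed (past_trace past)) \<inter> set is = {}"
    and "\<forall>(i, b, y, h)\<in>set past. set (probed h) \<subseteq> star G i"
  shows "feasible_trace G (past_trace past') \<and>
         (\<forall>(i, b, y, h)\<in>set past'. set (probed h) \<subseteq> star G i)"
  using assms(2-)
proof (induction "is" arbitrary: past)
  case Nil
  then show ?case by simp
next
  case (Cons i "is")
  obtain T h where T: "T \<in> set_pmf (rom past i (\<tau> i) (Y i))" and h: "h \<in> set_pmf (run_tree st T)"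
    and past': "past' \<in> set_pmf (process_arrivals rom \<tau> Y st is (past @ [(i, \<tau> i, Y i, h)]))"
    using Cons.prems(1) by auto
  have i: "i \<in> {1..n}" using Cons.prems(3) by simp
  note tr = rom_trace[OF i Cons.prems(4)[OF i] T h]
  let ?h0 = "past_trace past"
  have h0: "set (probed ?h0) \<subseteq> edges G" "matching (chosen ?h0)"
    "\<And>v. v \<in> onl G \<Longrightarrow> filter (\<lambda>e. snd e = v) (probed ?h0) \<in> con G v"
    using Cons.prems(5) by (auto simp: feasible_trace_def)
  have new: "i \<notin> snd ` set (probed ?h0)" using Cons.prems(6) by auto
  have star: "set (probed h) \<subseteq> star G i" using tr(3) by (simp add: star_def G_def)
  have "feasible_trace G (?h0 @ h)"
    unfolding feasible_trace_def
  proof (intro conjI ballI)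
    show "set (probed (?h0 @ h)) \<subseteq> edges G"
      using h0(1) tr(3) i by (auto simp: edges_def G_def)
  next
    fix v assume v: "v \<in> onl G"
    show "filter (\<lambda>e. snd e = v) (probed (?h0 @ h)) \<in> con G v"
    proof (cases "v = i")
      case True
      have "filter (\<lambda>e. snd e = v) (probed ?h0) = []"
        using new True by (auto simp: filter_empty_conv)
      moreover have "filter (\<lambda>e. snd e = v) (probed h) = probed h"
        using tr(3) True by (auto simp: filter_id_conv)
      ultimately show ?thesis using tr(1) True by (simp add: G_def)
    next
      case False
      have "filter (\<lambda>e. snd e = v) (probed h) = []"
        using tr(3) False by (auto simp: filter_empty_conv)
      then show ?thesis using h0(3)[OF v] by simp
    qed
  next
    have "i \<notin> snd ` chosen ?h0" using new chosen_subset_probed[of ?h0] by blast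
    then show "matching (chosen (?h0 @ h))"
      using tr(4) h0(2) unfolding matching_def by (auto simp: image_iff)
  qed
  moreover have "snd ` set (probed (?h0 @ h)) \<inter> set is = {}"
    using Cons.prems(2,6) tr(3) by auto
  ultimately show ?case
    using Cons.prems star by (intro Cons.IH[OF past']) (auto simp: past_trace_snoc)
qed

lemma online_run_rom_feasible:
  assumes "(\<tau>, past) \<in> set_pmf (online_run H n D rom Y)"
  shows "\<tau> \<in> set_pmf (types_pmf n D)"
    "feasible_trace (instantiate H n \<tau>) (past_trace past)"
    "\<forall>(i, b, y, h)\<in>set past. set (probed h) \<subseteq> star (instantiate H n \<tau>) i"
proof -
  obtain st where \<tau>: "\<tau> \<in> set_pmf (types_pmf n D)"
    and past: "past \<in> set_pmf (process_arrivals rom \<tau> Y st (sort_key Y [1..<Suc n]) [])"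
    using assms unfolding online_run_def by auto
  have on: "\<tau> i \<in> onl H" if "i \<in> {1..n}" for i using set_types_pmf[OF id \<tau> that] .
  have "[] \<in> con (instantiate H n \<tau>) v" if "v \<in> {1..n}" for v
    using Nil_in_con[OF on[OF that]] by force
  then have "feasible_trace (instantiate H n \<tau>) (past_trace past) \<and>
      (\<forall>(i, b, y, h)\<in>set past. set (probed h) \<subseteq> star (instantiate H n \<tau>) i)"
    by (intro process_rom_feasible[OF past])
       (use on in \<open>auto simp: past_trace_def feasible_trace_def matching_def\<close>)
  then show "feasible_trace (instantiate H n \<tau>) (past_trace past)"
    "\<forall>(i, b, y, h)\<in>set past. set (probed h) \<subseteq> star (instantiate H n \<tau>) i" by simp_all
  show "\<tau> \<in> set_pmf (types_pmf n D)" by fact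
qed

text \<open>Averaging over the types has replaced \<open>output_prob\<close> by \<open>zval\<close>.
  Later vertices enter with factor 1, so that the index set does not depend on \<open>Y\<close> and
  the product can be integrated coordinate by coordinate.\<close>

definition free_prob :: "'u \<Rightarrow> nat \<Rightarrow> (nat \<Rightarrow> real) \<Rightarrow> real" where
  "free_prob u t Y = (\<Prod>i\<in>{1..n} - {t}.
     if arrives_before Y i t then 1 - zval H x u i * accept_prob u i (Y i) else 1)"

lemma accept_prob_range: "0 \<le> accept_prob u i y \<and> accept_prob u i y \<le> 1"
  by (simp add: accept_prob_def)

lemma process_rom_eq_fresh_process:
  assumes \<tau>: "\<tau> \<in> set_pmf (types_pmf n D)"
  shows "bind_pmf (states_pmf (instantiate H n \<tau>))
           (\<lambda>st. process_arrivals rom \<tau> Y st (sort_key Y [1..<Suc n]) []) =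
         fresh_process (edge_prob (instantiate H n \<tau>)) rom \<tau> Y (sort_key Y [1..<Suc n]) []"
proof -
  let ?L = "sort_key Y [1..<Suc n]"
  have L: "set ?L = {1..n}" by auto
  have "states_pmf (instantiate H n \<tau>) =
      Pi_pmf (off H \<times> set ?L) False (\<lambda>e. bernoulli_pmf (edge_prob (instantiate H n \<tau>) e))"
    unfolding L by (simp add: states_pmf_def edges_def bernoulli_edge_prob)
  moreover have "bind_pmf
        (Pi_pmf (off H \<times> set ?L) False (\<lambda>e. bernoulli_pmf (edge_prob (instantiate H n \<tau>) e)))
        (\<lambda>st. process_arrivals rom \<tau> Y st ?L []) =
      fresh_process (edge_prob (instantiate H n \<tau>)) rom \<tau> Y ?L []"
  proof (rule presampled_states_eq_fresh_process)
    show "finite (off H)" using H by (simp add: stochastic_graph_def)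
    fix past i T st h
    assume i: "i \<in> set ?L" and T: "T \<in> set_pmf (rom past i (\<tau> i) (Y i))"
      and h: "h \<in> set_pmf (run_tree st T)"
    have i: "i \<in> {1..n}" using i by auto
    show "distinct (probed h) \<and> set (probed h) \<subseteq> off H \<times> {i}"
      using rom_trace(2,3)[OF i set_types_pmf[OF id \<tau> i] T h] by simp
  qed simp
  ultimately show ?thesis by simp
qed

lemma expectation_over_types:
  assumes i: "i \<in> {1..n}"
  shows "measure_pmf.expectation (D i) g = (\<Sum>b\<in>onl H. g b * pmf (D i) b)"
  by (rule integral_measure_pmf_real)
     (use i id in \<open>auto simp: known_id_input_def stochastic_graph_def subset_iff\<close>)

text \<open>For given types the probability is a product with one factor per vertex, depending only
  on the type of that vertex. Independence of the types turns the expectation of the product into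
  the product of the expectations.\<close>

lemma prob_online_run_chosen:
  assumes u: "u \<in> off H" and t: "t \<in> {1..n}" and b: "b \<in> onl H"
  shows "measure_pmf.prob (online_run H n D rom Y)
           {(\<tau>, past). \<tau> t = b \<and> (u, t) \<in> chosen (past_trace past)} =
         pr H (u, b) * xtilde H x u t b * (accept_prob u t (Y t) * free_prob u t Y)"
proof -
  define L where "L = sort_key Y [1..<Suc n]"
  let ?G = "instantiate H n"
  let ?X = "{(\<tau>, past). \<tau> t = b \<and> (u, t) \<in> chosen (past_trace past)}"
  define a where "a i = accept_prob u i (Y i)" for i
  \<comment> \<open>Vertex \<open>t\<close> must have type \<open>b\<close> and take
    \<open>u\<close>, earlier vertices must not take \<open>u\<close>, and later ones contribute the
    factor 1.\<close>
  define F where "F i c = (if i = t then if c = b then output_prob u t c * a t else 0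
      else if arrives_before Y i t then 1 - output_prob u i c * a i else 1)" for i c
  have L: "set L = {1..n}" "distinct L" by (auto simp: L_def)
  have before: "set (takeWhile (\<lambda>i. i \<noteq> t) L) = {i \<in> {1..n} - {t}. arrives_before Y i t}"
  proof -
    have "set (takeWhile (\<lambda>i. i \<noteq> t) L) = {i \<in> set L. arrives_before Y i t}"
    proof (rule set_takeWhile_arrives_before)
      show "sorted_wrt (arrives_before Y) L"
        unfolding L_def by (intro sorted_wrt_arrives_before_sort_key sorted_wrt_upt)
      show "t \<in> set L" using t unfolding L(1) .
    qed
    then show ?thesis unfolding L(1) by (auto simp: arrives_before_def)
  qed
  have a: "0 \<le> a i \<and> a i \<le> 1" for i using accept_prob_range by (simp add: a_def)
  have "online_run H n D rom Y = bind_pmf (types_pmf n D) (\<lambda>\<tau>. map_pmf (Pair \<tau>)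
      (bind_pmf (states_pmf (?G \<tau>)) (\<lambda>st. process_arrivals rom \<tau> Y st L [])))"
    unfolding online_run_def L_def by (simp add: map_bind_pmf)
  also have "\<dots> = bind_pmf (types_pmf n D) (\<lambda>\<tau>. map_pmf (Pair \<tau>)
      (fresh_process (edge_prob (?G \<tau>)) rom \<tau> Y L []))"
    using process_rom_eq_fresh_process[of _ Y, folded L_def] by (intro bind_pmf_cong refl) simp
  finally have "measure_pmf.prob (online_run H n D rom Y) ?X =
      measure_pmf.expectation (types_pmf n D) (\<lambda>\<tau>. measure_pmf.prob
        (fresh_process (edge_prob (?G \<tau>)) rom \<tau> Y L []) (Pair \<tau> -` ?X))"
    by (simp add: prob_bind_pmf)
  also have "\<dots> = measure_pmf.expectation (types_pmf n D) (\<lambda>\<tau>. \<Prod>i\<in>{1..n}. F i (\<tau> i))"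
  proof (rule expectation_cong_pmf)
    fix \<tau> assume \<tau>: "\<tau> \<in> set_pmf (types_pmf n D)"
    have "(\<Prod>i\<in>{1..n}. F i (\<tau> i)) = F t (\<tau> t) * (\<Prod>i\<in>{1..n} - {t}. F i (\<tau> i))"
      using t by (intro prod.remove) auto
    also have "(\<Prod>i\<in>{1..n} - {t}. F i (\<tau> i)) =
        (\<Prod>i\<in>{1..n} - {t}. if arrives_before Y i t then 1 - output_prob u i (\<tau> i) * a i else 1)"
      by (intro prod.cong refl) (simp add: F_def)
    also have "\<dots> = (\<Prod>i\<in>set (takeWhile (\<lambda>i. i \<noteq> t) L). 1 - output_prob u i (\<tau> i) * a i)"
      unfolding before by (rule prod.inter_filter[symmetric]) simp
    also have "\<dots> = (\<Prod>i\<leftarrow>takeWhile (\<lambda>i. i \<noteq> t) L. 1 - output_prob u i (\<tau> i) * a i)"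
      using L(2) by (simp add: prod.distinct_set_conv_list distinct_takeWhile)
    finally have prod: "(\<Prod>i\<in>{1..n}. F i (\<tau> i)) = F t (\<tau> t) *
        (\<Prod>i\<leftarrow>takeWhile (\<lambda>i. i \<noteq> t) L. 1 - output_prob u i (\<tau> i) * a i)" .
    show "measure_pmf.prob (fresh_process (edge_prob (?G \<tau>)) rom \<tau> Y L []) (Pair \<tau> -` ?X) =
        (\<Prod>i\<in>{1..n}. F i (\<tau> i))"
    proof (cases "\<tau> t = b")
      case True
      have "Pair \<tau> -` ?X = {past'. (u, t) \<in> chosen (past_trace past')}" using True by auto
      moreover have "measure_pmf.prob (fresh_process (edge_prob (?G \<tau>)) rom \<tau> Y L [])
            {past'. (u, t) \<in> chosen (past_trace past')} =
          output_prob u t (\<tau> t) * a t *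
          (\<Prod>i\<leftarrow>takeWhile (\<lambda>i. i \<noteq> t) L. 1 - output_prob u i (\<tau> i) * a i)"
        using prob_fresh_process_chosen[OF L(2), of \<tau> t u "[]" Y] L(1) t u set_types_pmf[OF id \<tau>]
        by (simp add: past_trace_def a_def)
      ultimately show ?thesis unfolding prod using True by (simp add: F_def)
    next
      case False
      then have "Pair \<tau> -` ?X = {}" by auto
      with False show ?thesis unfolding prod by (simp add: F_def)
    qed
  qed
  also have "\<dots> = (\<Prod>i\<in>{1..n}. measure_pmf.expectation (D i) (F i))"
    unfolding types_pmf_def
  proof (rule expectation_prod_Pi_pmf)
    fix i assume i: "i \<in> {1..n}"
    have sub: "set_pmf (D i) \<subseteq> onl H" using id i by (auto simp: known_id_input_def)
    then have "finite (set_pmf (D i))"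
      using H finite_subset by (auto simp: stochastic_graph_def)
    then show "integrable (measure_pmf (D i)) (F i)" by (rule integrable_measure_pmf_finite)
    fix c assume "c \<in> set_pmf (D i)"
    then have "c \<in> onl H" using sub by blast
    from output_prob_range[OF i this u] a[of i] show "F i c \<ge> 0"
      by (auto simp: F_def mult_le_one)
  qed simp
  also have "\<dots> = measure_pmf.expectation (D t) (F t) *
      (\<Prod>i\<in>{1..n} - {t}. measure_pmf.expectation (D i) (F i))"
    using t by (intro prod.remove) auto
  \<comment> \<open>The probability of type \<open>b\<close> cancels the denominator of
    \<open>output_prob\<close>.\<close>
  also have "measure_pmf.expectation (D t) (F t) = pr H (u, b) * xtilde H x u t b * a t"
  proof -
    have "measure_pmf.expectation (D t) (F t) =
        (\<Sum>c\<in>onl H. if c = b then output_prob u t c * a t * pmf (D t) c else 0)"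
      unfolding expectation_over_types[OF t] by (intro sum.cong) (auto simp: F_def)
    also have "\<dots> = output_prob u t b * a t * pmf (D t) b"
      using b H by (simp add: stochastic_graph_def)
    also have "\<dots> = pr H (u, b) * xtilde H x u t b * a t"
      using r[OF t b] by (simp add: output_prob_def)
    finally show ?thesis .
  qed
  also have "(\<Prod>i\<in>{1..n} - {t}. measure_pmf.expectation (D i) (F i)) = free_prob u t Y"
    unfolding free_prob_def
  proof (intro prod.cong refl)
    fix i assume i: "i \<in> {1..n} - {t}"
    then have i': "i \<in> {1..n}" by simp
    have one: "(\<Sum>c\<in>onl H. pmf (D i) c) = 1"
      using expectation_over_types[OF i', of "\<lambda>_. 1"] by simp
    have z: "(\<Sum>c\<in>onl H. output_prob u i c * pmf (D i) c) = zval H x u i"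
      unfolding zval_def
    proof (intro sum.cong refl)
      fix c assume "c \<in> onl H"
      from r[OF i' this] show "output_prob u i c * pmf (D i) c = pr H (u, c) * xtilde H x u i c"
        by (simp add: output_prob_def)
    qed
    have "(\<Sum>c\<in>onl H. (1 - output_prob u i c * a i) * pmf (D i) c) =
        (\<Sum>c\<in>onl H. pmf (D i) c) - (\<Sum>c\<in>onl H. output_prob u i c * pmf (D i) c) * a i"
      unfolding sum_distrib_right sum_subtractf[symmetric]
      by (intro sum.cong refl) (simp add: algebra_simps)
    then show "measure_pmf.expectation (D i) (F i) =
        (if arrives_before Y i t then 1 - zval H x u i * accept_prob u i (Y i) else 1)"
      using i one z unfolding expectation_over_types[OF i'] by (simp add: F_def a_def)
  qed
  finally show ?thesis by (simp add: a_def)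
qed

lemma expectation_online_run_weight:
  "measure_pmf.expectation (online_run H n D rom Y)
     (\<lambda>(\<tau>, past). trace_weight (instantiate H n \<tau>) (past_trace past)) =
   (\<Sum>u\<in>off H. \<Sum>t=1..n. \<Sum>b\<in>onl H. wt H (u, b) *
      (pr H (u, b) * xtilde H x u t b * (accept_prob u t (Y t) * free_prob u t Y)))"
proof -
  let ?R = "online_run H n D rom Y"
  let ?X = "\<lambda>u t b. {(\<tau>, past). \<tau> t = b \<and> (u, t) \<in> chosen (past_trace past)} ::
    ((nat \<Rightarrow> 'b) \<times> ('u, 'b) past) set"
  have fin: "finite (off H)" "finite (onl H)" using H by (auto simp: stochastic_graph_def)
  have "measure_pmf.expectation ?R
      (\<lambda>(\<tau>, past). trace_weight (instantiate H n \<tau>) (past_trace past)) =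
    measure_pmf.expectation ?R
      (\<lambda>\<omega>. \<Sum>u\<in>off H. \<Sum>t=1..n. \<Sum>b\<in>onl H. wt H (u, b) * indicator (?X u t b) \<omega>)"
  proof (intro expectation_cong_pmf, clarify)
    fix \<tau> past assume \<omega>: "(\<tau>, past) \<in> set_pmf ?R"
    let ?G = "instantiate H n \<tau>" and ?c = "chosen (past_trace past)"
    note R = online_run_rom_feasible[OF \<omega>]
    have sub: "?c \<subseteq> off H \<times> {1..n}"
      using R(2) chosen_subset_probed[of "past_trace past"]
      by (auto simp: feasible_trace_def edges_def)
    have "trace_weight ?G (past_trace past) =
        (\<Sum>e\<in>off H \<times> {1..n}. wt ?G e * indicator ?c e)"
      unfolding trace_weight_def using sub fin by (intro sum.mono_neutral_cong_left) auto
    also have "\<dots> = (\<Sum>u\<in>off H. \<Sum>t=1..n. wt H (u, \<tau> t) * indicator ?c (u, t))"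
      by (simp add: sum.cartesian_product')
    \<comment> \<open>Splitting by type replaces the random weight of an edge by constants times
      events.\<close>
    also have "\<dots> = (\<Sum>u\<in>off H. \<Sum>t=1..n. \<Sum>b\<in>onl H. wt H (u, b) * indicator (?X u t b) (\<tau>, past))"
    proof (intro sum.cong refl)
      fix u t assume t: "t \<in> {1..n}"
      have "(\<Sum>b\<in>onl H. wt H (u, b) * indicator (?X u t b) (\<tau>, past)) =
          (\<Sum>b\<in>onl H. if b = \<tau> t then wt H (u, b) * indicator ?c (u, t) else 0)"
        by (intro sum.cong) (auto simp: indicator_def)
      then show "wt H (u, \<tau> t) * indicator ?c (u, t) =
          (\<Sum>b\<in>onl H. wt H (u, b) * indicator (?X u t b) (\<tau>, past))"
        using set_types_pmf[OF id R(1) t] fin by simp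
    qed
    finally show "trace_weight ?G (past_trace past) =
        (\<Sum>u\<in>off H. \<Sum>t=1..n. \<Sum>b\<in>onl H. wt H (u, b) * indicator (?X u t b) (\<tau>, past))" .
  qed
  also have "\<dots> = (\<Sum>u\<in>off H. \<Sum>t=1..n. \<Sum>b\<in>onl H. wt H (u, b) * measure_pmf.prob ?R (?X u t b))"
  proof -
    have int: "integrable (measure_pmf ?R) (indicator X :: _ \<Rightarrow> real)" for X
      by (rule integrable_pmf_bounded[where B = 1]) (auto split: split_indicator)
    show ?thesis
      by (subst Bochner_Integration.integral_sum,
          (intro Bochner_Integration.integrable_sum integrable_mult_right int)[1],
          intro sum.cong refl)+ (simp add: int)
  qed
  also have "\<dots> = (\<Sum>u\<in>off H. \<Sum>t=1..n. \<Sum>b\<in>onl H. wt H (u, b) *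
      (pr H (u, b) * xtilde H x u t b * (accept_prob u t (Y t) * free_prob u t Y)))"
    by (intro sum.cong refl arg_cong2[where f = "(*)"] prob_online_run_chosen)
  finally show ?thesis .
qed

end

section \<open>Uniform arrival times\<close>

abbreviation "unif \<equiv> uniform_measure lborel {0..1 :: real}"

lemma prob_space_unif: "prob_space unif"
  by (intro prob_space_uniform_measure) auto

lemma integral_unif:
  fixes f :: "real \<Rightarrow> real"
  assumes [measurable]: "f \<in> borel_measurable borel"
  shows "(LINT s|unif. f s) = (LBINT s:{0..1}. f s)"
proof -
  have "unif = density lborel (\<lambda>s. indicator {0..1} s / emeasure lborel {0..1 :: real})"
    by (simp add: uniform_measure_def)
  also have "\<dots> = density lborel (\<lambda>s. ennreal (indicator {0..1} s))"
    by (intro density_cong) (auto simp: indicator_def)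
  finally show ?thesis
    by (simp add: integral_density set_lebesgue_integral_def)
qed

lemma interval_integral_exp_decay:
  fixes y z :: real
  assumes "0 \<le> y"
  shows "(LBINT s:{0..y}. z * exp (- s * z)) = 1 - exp (- y * z)"
proof -
  have "(LBINT s:{0..y}. z * exp (- s * z)) = - exp (- y * z) - (- exp (- 0 * z))"
    unfolding set_lebesgue_integral_def
    by (rule integral_FTC_atLeastAtMost[OF assms])
       (auto intro!: derivative_eq_intros continuous_intros
             simp: has_real_derivative_iff_has_vector_derivative[symmetric])
  then show ?thesis by simp
qed

lemma integrable_unif_bounded:
  fixes f :: "real \<Rightarrow> real"
  assumes "f \<in> borel_measurable borel" "\<And>s. \<bar>f s\<bar> \<le> B"
  shows "integrable unif f"
proof -
  interpret prob_space unif by (rule prob_space_unif)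
  show ?thesis using assms by (intro integrable_const_bound[where B = B]) auto
qed

text \<open>\<open>P\<close> is left open at \<open>s = y\<close>, so that either way of breaking a
  tie is covered; a single point has measure 0. On \<open>{0..1}\<close> the minimum with 1 has no
  effect.\<close>

lemma integral_unif_survival:
  fixes y z :: real
  assumes y: "0 \<le> y" "y \<le> 1" and z: "0 \<le> z"
    and [measurable]: "Measurable.pred borel P"
    and P: "\<And>s. s < y \<Longrightarrow> P s" "\<And>s. y < s \<Longrightarrow> \<not> P s"
  shows "(LINT s|unif. (if P s then 1 - z * min 1 (exp (- s * z)) else 1)) = exp (- y * z)"
proof -
  interpret prob_space unif by (rule prob_space_unif)
  let ?g = "\<lambda>s. if P s then z * min 1 (exp (- s * z)) else 0"
  have bound: "\<bar>?g s\<bar> \<le> z" for s using z by (auto simp: abs_mult intro!: mult_left_le)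
  have "(LINT s|unif. (if P s then 1 - z * min 1 (exp (- s * z)) else 1)) = (LINT s|unif. 1 - ?g s)"
    by (intro Bochner_Integration.integral_cong) auto
  also have "\<dots> = 1 - (LINT s|unif. ?g s)"
    using bound by (subst Bochner_Integration.integral_diff)
      (auto intro!: integrable_unif_bounded[where B = z] simp: prob_space[simplified])
  also have "(LINT s|unif. ?g s) = (LBINT s:{0..1}. ?g s)"
    by (rule integral_unif) measurable
  also have "\<dots> = (LBINT s:{0..y}. z * exp (- s * z))"
    unfolding set_lebesgue_integral_def
  proof (rule integral_cong_AE)
    show "AE s in lborel. indicator {0..1} s *\<^sub>R ?g s = indicator {0..y} s *\<^sub>R (z * exp (- s * z))"
      using AE_lborel_singleton[of y]
    proof eventually_elim
      case (elim s)
      show ?case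
      proof (cases "0 \<le> s")
        case True
        then have "exp (- s * z) \<le> 1" using z by simp
        with True elim P(1)[of s] P(2)[of s] y show ?thesis
          by (cases "s < y") (auto simp: min_def)
      qed simp
    qed
  qed measurable
  also have "\<dots> = 1 - exp (- y * z)" by (rule interval_integral_exp_decay[OF y(1)])
  finally show ?thesis by simp
qed

text \<open>The minima with 1 keep \<open>K\<close> between 0 and 1 at every point of the product
  space, not only at times in the unit interval, which gives integrability without exceptional
  sets.\<close>

lemma integral_survival_ge:
  fixes z :: "nat \<Rightarrow> real"
  assumes I: "finite I" "t \<in> I" and z: "\<And>i. i \<in> I \<Longrightarrow> 0 \<le> z i" "sum z I \<le> 1"
  defines "K \<equiv> \<lambda>Y. min 1 (exp (- Y t * z t)) *
    (\<Prod>i\<in>I - {t}. if arrives_before Y i t then 1 - z i * min 1 (exp (- Y i * z i)) else 1)"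
  shows "integrable (Pi\<^sub>M I (\<lambda>_. unif)) K" (is ?integrable)
    and "1 - 1 / exp 1 \<le> (LINT Y|Pi\<^sub>M I (\<lambda>_. unif). K Y)" (is ?bound)
proof -
  let ?M = "\<lambda>I. Pi\<^sub>M I (\<lambda>_ :: nat. unif)"
  interpret unif: prob_space unif by (rule prob_space_unif)
  interpret product_prob_space "\<lambda>_ :: nat. unif" by standard
  interpret P: prob_space "?M I" by (rule prob_space_PiM) (rule prob_space_unif)
  define J where "J = I - {t}"
  have J: "I = insert t J" "t \<notin> J" "finite J" using I by (auto simp: J_def)
  have z1: "z i \<le> 1" if "i \<in> I" for i
    using member_le_sum[of i I z] that z I by force
  have comp: "(\<lambda>Y. Y i) \<in> borel_measurable (?M L)" if "i \<in> L" for i L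
  proof -
    have "(\<lambda>Y. Y i) \<in> measurable (?M L) unif" using that by (rule measurable_component_singleton)
    then show ?thesis by (simp cong: measurable_cong_sets)
  qed
  \<comment> \<open>Separating the time \<open>y\<close> of \<open>t\<close> from the time
    \<open>s\<close> of \<open>i\<close> leaves, once \<open>y\<close> is fixed, a product of
    functions of single coordinates.\<close>
  define f where "f y i s = (if s < y \<or> s = y \<and> i < t then 1 - z i * min 1 (exp (- s * z i)) else 1)"
    for y s :: real and i
  have f_range: "0 \<le> f y i s \<and> f y i s \<le> 1" if "i \<in> I" for y i s
    using z(1)[OF that] z1[OF that] by (auto simp: f_def intro!: mult_le_one)
  have K: "K Y = min 1 (exp (- Y t * z t)) * (\<Prod>i\<in>J. f (Y t) i (Y i))" for Y
    by (simp add: K_def f_def J_def arrives_before_def)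
  have f_meas: "(\<lambda>Y. f (Y t) i (Y i)) \<in> borel_measurable (?M I)" if "i \<in> J" for i
  proof -
    have [measurable]: "(\<lambda>Y. Y i) \<in> borel_measurable (?M I)" "(\<lambda>Y. Y t) \<in> borel_measurable (?M I)"
      using that J(1) by (auto intro!: comp)
    \<comment> \<open>Whether a tie counts is decided by the fixed indices, so in either case the
      condition is a single comparison of two coordinates.\<close>
    have "(\<lambda>Y. f (Y t) i (Y i)) =
        (\<lambda>Y. if (if i < t then Y i \<le> Y t else Y i < Y t)
              then 1 - z i * min 1 (exp (- Y i * z i)) else 1)"
      by (auto simp: f_def fun_eq_iff)
    then show ?thesis by (cases "i < t") simp_all
  qed
  have K_meas [measurable]: "K \<in> borel_measurable (?M I)"
    unfolding K using comp[OF I(2)] f_meas by (intro borel_measurable_times borel_measurable_prod) auto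
  have K_range: "0 \<le> K Y \<and> K Y \<le> 1" for Y
  proof -
    have "0 \<le> (\<Prod>i\<in>J. f (Y t) i (Y i)) \<and> (\<Prod>i\<in>J. f (Y t) i (Y i)) \<le> 1"
      using f_range J(1) by (auto intro!: prod_nonneg prod_le_1)
    then show ?thesis unfolding K by (auto intro: mult_le_one)
  qed
  show ?integrable
    by (rule P.integrable_const_bound[where B = 1]) (use K_range in auto)
  have survive: "exp (- y) \<le> (\<integral>\<^sup>+ Y. ennreal (K (Y(t := y))) \<partial>?M J)"
    if y: "0 \<le> y" "y \<le> 1" for y
  proof -
    have f1: "(\<integral>\<^sup>+ s. ennreal (f y i s) \<partial>unif) = ennreal (exp (- y * z i))" if "i \<in> J" for i
    proof -
      have i: "i \<in> I" using that J by simp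
      have "(\<integral>\<^sup>+ s. ennreal (f y i s) \<partial>unif) = ennreal (LINT s|unif. f y i s)"
        by (intro nn_integral_eq_integral integrable_unif_bounded[where B = 1])
           (use f_range[OF i] in \<open>auto simp: f_def\<close>)
      also have "(LINT s|unif. f y i s) = exp (- y * z i)"
        unfolding f_def by (rule integral_unif_survival) (use y z(1)[OF i] in auto)
      finally show ?thesis .
    qed
    have "(\<integral>\<^sup>+ Y. ennreal (K (Y(t := y))) \<partial>?M J) =
        (\<integral>\<^sup>+ Y. ennreal (min 1 (exp (- y * z t))) * (\<Prod>i\<in>J. ennreal (f y i (Y i))) \<partial>?M J)"
    proof (intro nn_integral_cong)
      fix Y
      have "(\<Prod>i\<in>J. f y i ((Y(t := y)) i)) = (\<Prod>i\<in>J. f y i (Y i))"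
        using J(2) by (intro prod.cong) auto
      moreover have "(\<Prod>i\<in>J. ennreal (f y i (Y i))) = ennreal (\<Prod>i\<in>J. f y i (Y i))"
        using f_range J(1) by (intro prod_ennreal) auto
      ultimately show "ennreal (K (Y(t := y))) =
          ennreal (min 1 (exp (- y * z t))) * (\<Prod>i\<in>J. ennreal (f y i (Y i)))"
        using f_range J(1) by (simp add: K ennreal_mult prod_nonneg)
    qed
    also have "\<dots> = ennreal (min 1 (exp (- y * z t))) * (\<Prod>i\<in>J. \<integral>\<^sup>+ s. ennreal (f y i s) \<partial>unif)"
    proof (subst nn_integral_cmult)
      show "(\<lambda>Y. \<Prod>i\<in>J. ennreal (f y i (Y i))) \<in> borel_measurable (?M J)"
      proof (intro borel_measurable_prod_ennreal)
        fix i assume "i \<in> J"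
        then have [measurable]: "(\<lambda>Y. Y i) \<in> borel_measurable (?M J)" by (rule comp)
        show "(\<lambda>Y. ennreal (f y i (Y i))) \<in> borel_measurable (?M J)" unfolding f_def by measurable
      qed
      have "(\<integral>\<^sup>+ Y. (\<Prod>i\<in>J. ennreal (f y i (Y i))) \<partial>?M J) =
          (\<Prod>i\<in>J. \<integral>\<^sup>+ s. ennreal (f y i s) \<partial>unif)"
        by (intro product_nn_integral_prod J(3)) (simp add: f_def)
      then show "ennreal (min 1 (exp (- y * z t))) * (\<integral>\<^sup>+ Y. (\<Prod>i\<in>J. ennreal (f y i (Y i))) \<partial>?M J) =
          ennreal (min 1 (exp (- y * z t))) * (\<Prod>i\<in>J. \<integral>\<^sup>+ s. ennreal (f y i s) \<partial>unif)" by simp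
    qed
    also have "(\<Prod>i\<in>J. \<integral>\<^sup>+ s. ennreal (f y i s) \<partial>unif) = ennreal (\<Prod>i\<in>J. exp (- y * z i))"
      using f1 by (simp add: prod_ennreal)
    \<comment> \<open>The coin of \<open>t\<close> completes the product over \<open>J\<close> to
      one over all of \<open>I\<close>.\<close>
    also have "min 1 (exp (- y * z t)) = exp (- y * z t)"
      using y z(1)[OF I(2)] by (intro min.absorb2) simp
    also have "ennreal (exp (- y * z t)) * ennreal (\<Prod>i\<in>J. exp (- y * z i)) =
        ennreal (\<Prod>i\<in>I. exp (- y * z i))"
      using J by (simp add: ennreal_mult[symmetric] prod_nonneg)
    also have "(\<Prod>i\<in>I. exp (- y * z i)) = exp (- y * sum z I)"
      using I(1) by (simp add: exp_sum sum_distrib_left)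
    finally have eq: "(\<integral>\<^sup>+ Y. ennreal (K (Y(t := y))) \<partial>?M J) = ennreal (exp (- y * sum z I))" .
    show ?thesis
      unfolding eq using y z(2) by (intro ennreal_leI) (simp add: mult_left_le)
  qed
  \<comment> \<open>The integral formally ranges over all reals; the indicator confines the
    comparison to the times for which \<open>survive\<close> holds.\<close>
  have "ennreal (1 - 1 / exp 1) = (\<integral>\<^sup>+ y. ennreal (exp (- y)) * indicator {0..1} y \<partial>unif)"
  proof -
    have "(\<integral>\<^sup>+ y. ennreal (exp (- y)) * indicator {0..1} y \<partial>unif) =
        (\<integral>\<^sup>+ y. ennreal (exp (- y) * indicator {0..1} y) \<partial>unif)"
      by (intro nn_integral_cong) (auto split: split_indicator)
    also have "\<dots> = ennreal (LINT y|unif. exp (- y) * indicator {0..1} y)"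
      by (intro nn_integral_eq_integral integrable_unif_bounded[where B = 1])
         (auto split: split_indicator)
    also have "(LINT y|unif. exp (- y) * indicator {0..1} y) =
        (LBINT y:{0..1}. exp (- y) * indicator {0..1} y)"
      by (rule integral_unif) measurable
    also have "\<dots> = (LBINT s:{0..1}. 1 * exp (- s * 1))"
      by (intro set_lebesgue_integral_cong) auto
    also have "\<dots> = 1 - 1 / exp 1"
      by (subst interval_integral_exp_decay) (simp_all add: exp_minus field_simps)
    finally show ?thesis ..
  qed
  also have "\<dots> \<le> (\<integral>\<^sup>+ y. (\<integral>\<^sup>+ Y. ennreal (K (Y(t := y))) \<partial>?M J) \<partial>unif)"
    by (intro nn_integral_mono) (auto split: split_indicator intro: survive)
  \<comment> \<open>Tonelli, with the coordinate \<open>t\<close> split off from the product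
    measure.\<close>
  also have "\<dots> = (\<integral>\<^sup>+ Y. ennreal (K Y) \<partial>?M I)"
    unfolding J(1)
    by (rule product_nn_integral_insert_rev[OF J(3,2), symmetric])
       (use K_meas in \<open>simp flip: J(1)\<close>)
  also have "\<dots> = ennreal (LINT Y|?M I. K Y)"
    using \<open>?integrable\<close> K_range by (intro nn_integral_eq_integral) auto
  finally show ?bound
    using K_range by (subst (asm) ennreal_le_iff) (auto intro!: Bochner_Integration.integral_nonneg)
qed

section \<open>The edges probed on one arrival\<close>

primrec probe_prefix :: "('e \<Rightarrow> bool) \<Rightarrow> 'e list \<Rightarrow> 'e list" where
  "probe_prefix st [] = []"
| "probe_prefix st (e # es) = e # (if st e then [] else probe_prefix st es)"

text \<open>The acceptance coin is tossed only after the last probe, so it cannot affect which edges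
  are probed. In ROM-ID the past and the arrival time enter only through \<open>acc\<close>.\<close>

lemma map_probed_run_probe_until_active:
  "map_pmf probed (run_tree st (probe_until_active acc es)) = return_pmf (probe_prefix st es)"
proof (induction es)
  case (Cons e es)
  have "map_pmf (\<lambda>h. probed ((e, False, False) # h)) (run_tree st (probe_until_active acc es)) =
      map_pmf ((#) e) (map_pmf probed (run_tree st (probe_until_active acc es)))"
    by (simp add: pmf.map_comp o_def)
  then show ?case
    by (simp add: run_tree_Probe Cons map_bind_pmf bind_map_pmf bind_return_pmf pmf.map_comp o_def)
qed simp

lemma probe_prefix_prefix:
  "prefix (probe_prefix st es) es \<and>
   (probe_prefix st es = es \<or> (probe_prefix st es \<noteq> [] \<and> st (last (probe_prefix st es))))"
  by (induction es) auto

section \<open>Guarantee and non-adaptivity of ROM-ID\<close>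

context rom_id_input
begin

lemma zval_nonneg:
  assumes "u \<in> off H" "i \<in> {1..n}"
  shows "0 \<le> zval H x u i"
  unfolding zval_def
proof (rule sum_nonneg)
  fix b assume "b \<in> onl H"
  then show "0 \<le> pr H (u, b) * xtilde H x u i b"
    using output_prob_range[OF assms(2) _ assms(1), of b] r[OF assms(2), of b]
    by (simp add: output_prob_def zero_le_divide_iff)
qed

lemma sum_zval_le_1:
  assumes "u \<in> off H"
  shows "(\<Sum>i=1..n. zval H x u i) \<le> 1"
proof -
  have "(\<Sum>i=1..n. \<Sum>b\<in>onl H. \<Sum>es\<in>{es\<in>con H b. (u, b) \<in> set es}.
         pr H (u, b) * gprob H (before (u, b) es) * x i es b) \<le> 1"
    using feasible assms by (simp add: lp_feasible_def)
  then show ?thesis by (simp add: zval_def xtilde_def sum_distrib_left mult.assoc)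
qed

lemma lp_value_eq:
  "lp_value H n x =
     (\<Sum>u\<in>off H. \<Sum>t=1..n. \<Sum>b\<in>onl H. wt H (u, b) * (pr H (u, b) * xtilde H x u t b))"
proof -
  have "(\<Sum>es\<in>con H b. val H es * x t es b) =
      (\<Sum>u\<in>off H. wt H (u, b) * (pr H (u, b) * xtilde H x u t b))" if b: "b \<in> onl H" for t b
  proof -
    have xt: "xtilde H x u t b = (\<Sum>es\<in>con H b. reach_prob (pr H) (u, b) es * x t es b)" for u
      using sum_containing_strings[OF finite_con[OF H b], of 1] by (simp add: xtilde_def)
    have "(\<Sum>es\<in>con H b. val H es * x t es b) = (\<Sum>es\<in>con H b. \<Sum>u\<in>off H.
        pr H (u, b) * wt H (u, b) * reach_prob (pr H) (u, b) es * x t es b)"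
      by (intro sum.cong refl) (simp add: val_eq_sum_reach_prob[OF H b] sum_distrib_right)
    also have "\<dots> = (\<Sum>u\<in>off H. wt H (u, b) * (pr H (u, b) * xtilde H x u t b))"
      unfolding xt sum_distrib_left by (subst sum.swap) (simp add: mult_ac)
    finally show ?thesis .
  qed
  then have "lp_value H n x = (\<Sum>t=1..n. \<Sum>b\<in>onl H. \<Sum>u\<in>off H.
      wt H (u, b) * (pr H (u, b) * xtilde H x u t b))"
    unfolding lp_value_def by (intro sum.cong refl)
  also have "\<dots> = (\<Sum>t=1..n. \<Sum>u\<in>off H. \<Sum>b\<in>onl H. wt H (u, b) * (pr H (u, b) * xtilde H x u t b))"
    by (intro sum.cong refl sum.swap)
  also have "\<dots> = (\<Sum>u\<in>off H. \<Sum>t=1..n. \<Sum>b\<in>onl H. wt H (u, b) * (pr H (u, b) * xtilde H x u t b))"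
    by (rule sum.swap)
  finally show ?thesis .
qed

text \<open>The bound holds term by term: each nonnegative contribution to the LP value is
  multiplied by a factor whose integral is at least \<open>1 - 1 / exp 1\<close>.\<close>

theorem rom_expected_weight_ge:
  "online_expected_weight H n D rom \<ge> (1 - 1 / exp 1) * lp_value H n x"
proof -
  let ?c = "\<lambda>u t b. wt H (u, b) * (pr H (u, b) * xtilde H x u t b)"
  let ?K = "\<lambda>u t Y. accept_prob u t (Y t) * free_prob u t Y"
  let ?M = "arrival_times n"
  have K: "integrable ?M (?K u t)" "1 - 1 / exp 1 \<le> (LINT Y|?M. ?K u t Y)"
    if "u \<in> off H" "t \<in> {1..n}" for u t
    using integral_survival_ge[of "{1..n}" t "zval H x u"] that zval_nonneg sum_zval_le_1
    unfolding arrival_times_def accept_prob_def free_prob_def by auto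
  have c: "0 \<le> ?c u t b" if "u \<in> off H" "t \<in> {1..n}" "b \<in> onl H" for u t b
    using wt_nonneg[OF H that(1,3)] output_prob_range[OF that(2,3,1)] r[OF that(2,3)]
    by (simp add: output_prob_def zero_le_divide_iff)
  have "online_expected_weight H n D rom =
      (LINT Y|?M. (\<Sum>u\<in>off H. \<Sum>t=1..n. \<Sum>b\<in>onl H. ?c u t b * ?K u t Y))"
    unfolding online_expected_weight_def expectation_online_run_weight by (simp add: mult.assoc)
  also have "\<dots> = (\<Sum>u\<in>off H. \<Sum>t=1..n. \<Sum>b\<in>onl H. ?c u t b * (LINT Y|?M. ?K u t Y))"
    by (subst Bochner_Integration.integral_sum,
        (intro Bochner_Integration.integrable_sum integrable_mult_right K; assumption)[1],
        intro sum.cong refl)+ (simp add: K)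
  also have "\<dots> \<ge> (\<Sum>u\<in>off H. \<Sum>t=1..n. \<Sum>b\<in>onl H. ?c u t b * (1 - 1 / exp 1))"
    by (intro sum_mono mult_left_mono K c)
  also have "(\<Sum>u\<in>off H. \<Sum>t=1..n. \<Sum>b\<in>onl H. ?c u t b * (1 - 1 / exp 1)) =
      (1 - 1 / exp 1) * lp_value H n x"
    by (simp only: lp_value_eq sum_distrib_right mult.commute[of "1 - 1 / exp 1"])
  finally show ?thesis .
qed

theorem rom_non_adaptive: "non_adaptive H n D rom"
proof -
  define \<kappa> where "\<kappa> i b = map_pmf (onto i) (string_pmf H D x i b)" for i b
  \<comment> \<open>Each string is coupled with its own probed prefix, so that \<open>\<rho>\<close>
    is an image of \<open>\<kappa>\<close>.\<close>
  define \<rho> where "\<rho> i b st = map_pmf (probe_prefix st) (\<kappa> i b)" for i b st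
  have "map_pmf probed (bind_pmf (rom past i b y) (run_tree st)) = \<rho> i b st" for past i b y st
    unfolding rom_id_def bind_map_pmf map_bind_pmf map_probed_run_probe_until_active \<rho>_def \<kappa>_def
      pmf.map_comp o_def
    by (simp add: map_pmf_def)
  moreover have "rel_pmf (\<lambda>es fs. prefix fs es \<and> (fs = es \<or> (fs \<noteq> [] \<and> st (last fs))))
      (\<kappa> i b) (\<rho> i b st)" for i b st
    unfolding \<rho>_def pmf.rel_map by (intro pmf.rel_refl_strong probe_prefix_prefix)
  moreover have "online_algorithm H n D rom"
    unfolding online_algorithm_def using online_run_rom_feasible by blast
  ultimately show ?thesis unfolding non_adaptive_def by blast
qed

end

theorem theorem2:
  fixes H :: "('u, 'b) sgraph" and n :: nat and D :: "nat \<Rightarrow> 'b pmf" and x :: "('u, 'b) lp_var"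
  assumes "known_id_input H n D"
    and "\<forall>i\<in>{1..n}. \<forall>b\<in>onl H. pmf (D i) b > 0"
    and "lp_optimal H n D x"
  shows "online_expected_weight H n D (rom_id H D x) \<ge> (1 - 1 / exp 1) * OPT_id H n D \<and>
         non_adaptive H n D (rom_id H D x)"
proof -
  interpret rom_id_input H n D x
    by standard (use assms in \<open>auto simp: lp_optimal_def\<close>)
  have "(1 - 1 / exp 1) * OPT_id H n D \<le> (1 - 1 / exp 1) * lp_value H n x"
    by (intro mult_left_mono OPT_id_le_lp_value[OF assms]) simp
  also note rom_expected_weight_ge
  finally show ?thesis using rom_non_adaptive by simp
qed

end
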